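(* Let $\{(x^i,y_i)\}_{i=1}^n\subset\mathbb{R}_+^d\times[K]$, $p_w,p_u\in(1,\infty)$, $\rho_w,\rho_u>0$, $n_1\in\mathbb{N}$, $\epsilon>0$ and $\alpha\in\mathbb{R}^{n_1}$ with $\alpha_l\ge 1$ for all $l\in[n_1]$. Define $$\rho_x=\max_{i\in[n]}\|x^i\|_1,\qquad \xi_1=\rho_w\sum_{l=1}^{n_1}(\rho_u\rho_x)^{\alpha_l},\qquad \xi_2=\rho_w\sum_{l=1}^{n_1}\alpha_l(\rho_u\rho_x)^{\alpha_l},$$ and let $A\in\mathbb{R}^{(K+1)\times(K+1)}_{++}$ be given by $$A_{l,m}=4(p_w'-1)\xi_1,\quad A_{l,K+1}=2(p_w'-1)(2\xi_2+\|\alpha\|_\infty),$$ $$A_{K+1,m}=2(p_u'-1)(2\xi_1+1),\quad A_{K+1,K+1}=2(p_u'-1)(2\xi_2+\|\alpha\|_\infty-1),$$ for all $l,m\in[K]$. If the spectral radius satisfies $\rho(A)<1$, then the problem $\max_{(w,u)\in S_+}\Phi(w,u)$ has a unique global maximizer $(w^*,u^* )$, and it lies in $S_{++}$. Moreover, for every $(w^0,u^0)\in S_{++}$, the sequence defined by $(w^{k+1},u^{k+1})=G^{\Phi}(w^k,u^k)$ satisfies $\lim_{k\to\infty}(w^k,u^k)=(w^*,u^* )$, and there exists $R>0$ such that $\|(w^k,u^k)-(w^*,u^* )\|_\infty\le R\,\rho(A)^k$ for all $k\in\mathbb{N}$.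
   Context: Notation: $[m]=\{1,\dots,m\}$, $\mathbb{R}_+=[0,\infty)$, $\mathbb{R}_{++}=(0,\infty)$. For $p\in(1,\infty)$, $p'=p/(p-1)$ and $\psi_p(z)=\operatorname{sign}(z)|z|^{p-1}$, applied componentwise to vectors/matrices. For a matrix, $\|\cdot\|_p$ denotes the entrywise $\ell_p$ norm (the matrix viewed as a vector); $\|\cdot\|_\infty$ of a pair $(w,u)$ is the maximum absolute entry. $\rho(A)$ is the spectral radius. Setting (one hidden layer network): data $(x^i,y_i)\in\mathbb{R}^d_+\times[K]$, $i\in[n]$. Parameters $w\in\mathbb{R}^{K\times n_1}_+$ with rows $w_1,\dots,w_K\in\mathbb{R}^{n_1}_+$ and $u\in\mathbb{R}^{n_1\times d}_+$. For $\alpha\in\mathbb{R}^{n_1}$ with all $\alpha_l\ge1$, the network is $f_r(w,u)(x)=\sum_{l=1}^{n_1}w_{r,l}\big(\sum_{m=1}^d u_{lm}x_m\big)^{\alpha_l}$, $r\in[K]$. Loss: $L(y,f(x))=-f_y(x)+\log\sum_{j=1}^K e^{f_j(x)}$. Objective, for $\epsilon>0$: $$\Phi(w,u)=\frac1n\sum_{i=1}^n\Big[-L\big(y_i,f(w,u)(x^i)\big)+\sum_{r=1}^K f_r(w,u)(x^i)\Big]+\epsilon\Big(\sum_{r=1}^K\sum_{l=1}^{n_1}w_{r,l}+\sum_{l=1}^{n_1}\sum_{m=1}^d u_{lm}\Big).$$ Feasible set: $S_+=\{(w,u)\in\mathbb{R}^{K\times n_1}_+\times\mathbb{R}^{n_1\times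 d}_+ : \|u\|_{p_u}=\rho_u,\ \|w_i\|_{p_w}=\rho_w\ \forall i\in[K]\}$, and $S_{++}$ is the same set with $\mathbb{R}_+$ replaced by $\mathbb{R}_{++}$ (all entries strictly positive). The map $G^\Phi$ is $$G^{\Phi}(w,u)=\Big(\tfrac{\rho_w\psi_{p_w'}(\nabla_{w_1}\Phi(w,u))}{\|\psi_{p_w'}(\nabla_{w_1}\Phi(w,u))\|_{p_w}},\dots,\tfrac{\rho_w\psi_{p_w'}(\nabla_{w_K}\Phi(w,u))}{\|\psi_{p_w'}(\nabla_{w_K}\Phi(w,u))\|_{p_w}},\tfrac{\rho_u\psi_{p_u'}(\nabla_u\Phi(w,u))}{\|\psi_{p_u'}(\nabla_u\Phi(w,u))\|_{p_u}}\Big),$$ where $\nabla_{w_i}\Phi$, $\nabla_u\Phi$ are partial gradients. *)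

theory Defs
  imports "HOL-Analysis.Analysis" "Jordan_Normal_Form.Spectral_Radius"
begin

no_notation Matrix.vec_index (infixl "$" 100)

text \<open>Index types: 'k = classes [K], 'h = hidden units [n1], 'd = input coordinates [d],
  'n = data points [n].  Parameters: w :: real^'h^'k (row r is w_r), u :: real^'d^'h.\<close>

definition conj_exp :: "real \<Rightarrow> real" where
  "conj_exp p = p / (p - 1)"

definition psi :: "real \<Rightarrow> real \<Rightarrow> real" where
  "psi p z = sgn z * \<bar>z\<bar> powr (p - 1)"

definition lp_vec :: "real \<Rightarrow> real^'a \<Rightarrow> real" where
  "lp_vec p v = (\<Sum>i\<in>UNIV. \<bar>v $ i\<bar> powr p) powr (1 / p)"

definition lp_mat :: "real \<Rightarrow> real^'b^'a \<Rightarrow> real" where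
  "lp_mat p M = (\<Sum>i\<in>UNIV. \<Sum>j\<in>UNIV. \<bar>M $ i $ j\<bar> powr p) powr (1 / p)"

definition l1_vec :: "real^'a \<Rightarrow> real" where
  "l1_vec v = (\<Sum>i\<in>UNIV. \<bar>v $ i\<bar>)"

definition net :: "(real^'h) \<Rightarrow> real^'h^'k \<Rightarrow> real^'d^'h \<Rightarrow> real^'d \<Rightarrow> 'k \<Rightarrow> real" where
  "net \<alpha> w u x r = (\<Sum>l\<in>UNIV. w $ r $ l * (\<Sum>m\<in>UNIV. u $ l $ m * x $ m) powr (\<alpha> $ l))"

definition loss :: "'k::finite \<Rightarrow> ('k \<Rightarrow> real) \<Rightarrow> real" where
  "loss y f = - f y + ln (\<Sum>j\<in>UNIV. exp (f j))"

definition Phi :: "('n::finite \<Rightarrow> real^'d) \<Rightarrow> ('n \<Rightarrow> 'k::finite) \<Rightarrow> real^'h \<Rightarrow> real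
                   \<Rightarrow> (real^'h^'k) \<times> (real^'d^'h) \<Rightarrow> real" where
  "Phi x y \<alpha> \<epsilon> z = (case z of (w, u) \<Rightarrow>
     (1 / real CARD('n)) * (\<Sum>i\<in>UNIV. - loss (y i) (net \<alpha> w u (x i))
                                         + (\<Sum>r\<in>UNIV. net \<alpha> w u (x i) r))
     + \<epsilon> * ((\<Sum>r\<in>UNIV. \<Sum>l\<in>UNIV. w $ r $ l) + (\<Sum>l\<in>UNIV. \<Sum>m\<in>UNIV. u $ l $ m)))"

definition grad_w :: "((real^'h^'k) \<times> (real^'d^'h) \<Rightarrow> real) \<Rightarrow> (real^'h^'k) \<times> (real^'d^'h)
                      \<Rightarrow> 'k \<Rightarrow> real^'h" where
  "grad_w F z r = (\<chi> l. frechet_derivative F (at z) (axis r (axis l 1), 0))"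

definition grad_u :: "((real^'h^'k) \<times> (real^'d^'h) \<Rightarrow> real) \<Rightarrow> (real^'h^'k) \<times> (real^'d^'h)
                      \<Rightarrow> real^'d^'h" where
  "grad_u F z = (\<chi> l m. frechet_derivative F (at z) (0, axis l (axis m 1)))"

definition G_map :: "real \<Rightarrow> real \<Rightarrow> real \<Rightarrow> real \<Rightarrow> ((real^'h^'k) \<times> (real^'d^'h) \<Rightarrow> real)
                     \<Rightarrow> (real^'h^'k) \<times> (real^'d^'h) \<Rightarrow> (real^'h^'k) \<times> (real^'d^'h)" where
  "G_map pw pu \<rho>w \<rho>u F z =
     ((\<chi> r. (let v = (\<chi> l. psi (conj_exp pw) (grad_w F z r $ l)) in (\<rho>w / lp_vec pw v) *\<^sub>R v)),
      (let M = (\<chi> l m. psi (conj_exp pu) (grad_u F z $ l $ m)) in (\<rho>u / lp_mat pu M) *\<^sub>R M))"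

definition S_plus :: "real \<Rightarrow> real \<Rightarrow> real \<Rightarrow> real \<Rightarrow> ((real^'h^'k) \<times> (real^'d^'h)) set" where
  "S_plus pw pu \<rho>w \<rho>u = {(w, u). (\<forall>r l. w $ r $ l \<ge> 0) \<and> (\<forall>l m. u $ l $ m \<ge> 0)
      \<and> lp_mat pu u = \<rho>u \<and> (\<forall>r. lp_vec pw (w $ r) = \<rho>w)}"

definition S_pplus :: "real \<Rightarrow> real \<Rightarrow> real \<Rightarrow> real \<Rightarrow> ((real^'h^'k) \<times> (real^'d^'h)) set" where
  "S_pplus pw pu \<rho>w \<rho>u = {(w, u). (\<forall>r l. w $ r $ l > 0) \<and> (\<forall>l m. u $ l $ m > 0)
      \<and> lp_mat pu u = \<rho>u \<and> (\<forall>r. lp_vec pw (w $ r) = \<rho>w)}"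

definition sup_norm_pair :: "(real^'h^'k) \<times> (real^'d^'h) \<Rightarrow> real" where
  "sup_norm_pair z = (case z of (w, u) \<Rightarrow>
     max (Max {\<bar>w $ r $ l\<bar> | r l. True}) (Max {\<bar>u $ l $ m\<bar> | l m. True}))"

text \<open>The (K+1)x(K+1) matrix A; rows/columns 0..K-1 correspond to [K], row/column K to K+1.\<close>
definition A_mat :: "nat \<Rightarrow> real \<Rightarrow> real \<Rightarrow> real \<Rightarrow> real \<Rightarrow> real \<Rightarrow> real Matrix.mat" where
  "A_mat K pw pu \<xi>1 \<xi>2 anorm = Matrix.mat (K + 1) (K + 1) (\<lambda>(i, j).
     if i < K \<and> j < K then 4 * (conj_exp pw - 1) * \<xi>1
     else if i < K then 2 * (conj_exp pw - 1) * (2 * \<xi>2 + anorm)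
     else if j < K then 2 * (conj_exp pu - 1) * (2 * \<xi>1 + 1)
     else 2 * (conj_exp pu - 1) * (2 * \<xi>2 + anorm - 1))"

end

theory Submission
  imports Defs
begin

text \<open>
  Measure the distance of two positive points coordinatewise and multiplicatively: a and b are
  \<kappa>-close if each is at most exp \<kappa> times the other. Closeness is inherited by sums,
  products and powers of nonnegative quantities, and the partial derivatives of the objective are
  built from the parameters by these operations, apart from the softmax factors. Those are
  controlled because the network outputs, being bounded by \<xi>1, change additively by at most
  \<xi>1 a + \<xi>2 b when w and u are a-close and b-close to their perturbations. Hence G maps closeness
  (a, ..., a, b) to at most A(a, ..., a, b). As A is constant on blocks, its Perron eigenvector has
  the form (s, ..., s, t), so G is a contraction with factor the Perron eigenvalue, which is at most
  the spectral radius. A maximizer exists by compactness, has no zero coordinate since every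
  partial derivative is at least \<epsilon> while returning to an lp sphere costs only O(t^p), and then is
  a fixed point of G by the Lagrange condition. Uniqueness and the rate follow from the contraction.
\<close>

section \<open>Multiplicative closeness\<close>

text \<open>For positive numbers this is \<bar>ln a - ln b\<bar> \<le> \<kappa>, a bound in the
  Thompson metric. The product form also admits zeros, each close only to zero. Zeros occur in
  preactivations with vanishing input, in softmax complements with a single class, and at boundary
  points of the feasible set.\<close>

definition ratio_bound :: "real \<Rightarrow> real \<Rightarrow> real \<Rightarrow> bool" where
  "ratio_bound \<kappa> a b \<longleftrightarrow> 0 \<le> a \<and> 0 \<le> b \<and> a \<le> exp \<kappa> * b \<and> b \<le> exp \<kappa> * a"

lemma ratio_bound_refl: "0 \<le> \<kappa> \<Longrightarrow> 0 \<le> a \<Longrightarrow> ratio_bound \<kappa> a a"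
  by (simp add: ratio_bound_def mult_le_cancel_right1)

lemma ratio_bound_mono:
  assumes "ratio_bound \<kappa> a b" "\<kappa> \<le> \<kappa>'" shows "ratio_bound \<kappa>' a b"
proof -
  have "exp \<kappa> * c \<le> exp \<kappa>' * c" if "0 \<le> c" for c
    using that assms(2) by (simp add: mult_right_mono)
  then show ?thesis using assms(1) unfolding ratio_bound_def by (meson order_trans)
qed

lemma ratio_bound_sum:
  assumes "\<And>i. i \<in> I \<Longrightarrow> ratio_bound \<kappa> (f i) (g i)"
  shows "ratio_bound \<kappa> (sum f I) (sum g I)"
  using assms unfolding ratio_bound_def
  by (auto simp: sum_distrib_left intro!: sum_nonneg sum_mono)

lemma ratio_bound_add: "ratio_bound \<kappa> a b \<Longrightarrow> ratio_bound \<kappa> c d \<Longrightarrow> ratio_bound \<kappa> (a + c) (b + d)"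
  unfolding ratio_bound_def by (auto simp: distrib_left)

lemma ratio_bound_mult:
  assumes "ratio_bound \<kappa> a b" "ratio_bound \<mu> c d" shows "ratio_bound (\<kappa> + \<mu>) (a * c) (b * d)"
proof -
  have "a * c \<le> (exp \<kappa> * b) * (exp \<mu> * d)" "b * d \<le> (exp \<kappa> * a) * (exp \<mu> * c)"
    using assms unfolding ratio_bound_def by (auto intro!: mult_mono)
  then show ?thesis using assms unfolding ratio_bound_def by (simp add: exp_add mult_ac)
qed

lemma ratio_bound_inverse:
  assumes "ratio_bound \<kappa> a b" shows "ratio_bound \<kappa> (inverse a) (inverse b)"
proof (cases "a = 0 \<or> b = 0")
  \<comment> \<open>Closeness makes both numbers vanish together, and
    \<open>inverse 0 = 0\<close>.\<close>
  case True
  then show ?thesis using assms by (auto simp: ratio_bound_def zero_le_mult_iff)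
next
  case False
  then have "a > 0" "b > 0" using assms by (auto simp: ratio_bound_def)
  then show ?thesis using assms by (auto simp: ratio_bound_def field_simps)
qed

lemma ratio_bound_divide: "ratio_bound \<kappa> a b \<Longrightarrow> ratio_bound \<mu> c d \<Longrightarrow> ratio_bound (\<kappa> + \<mu>) (a / c) (b / d)"
  by (simp add: divide_inverse ratio_bound_mult ratio_bound_inverse)

lemma ratio_bound_powr:
  assumes "ratio_bound \<kappa> a b" "0 \<le> q" shows "ratio_bound (q * \<kappa>) (a powr q) (b powr q)"
proof -
  have "a powr q \<le> (exp \<kappa> * b) powr q" "b powr q \<le> (exp \<kappa> * a) powr q"
    using assms unfolding ratio_bound_def by (auto intro!: powr_mono2)
  then show ?thesis using assms
    by (auto simp: ratio_bound_def powr_mult exp_powr_real mult_ac)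
qed

lemma ratio_bound_const_mult:
  assumes "ratio_bound \<kappa> a b" "0 \<le> c" shows "ratio_bound \<kappa> (c * a) (c * b)"
  using ratio_bound_mult[OF ratio_bound_refl[of 0 c] assms(1)] assms(2) by simp

lemma ratio_bound_exp: "\<bar>a - b\<bar> \<le> \<kappa> \<Longrightarrow> ratio_bound \<kappa> (exp a) (exp b)"
  by (auto simp: ratio_bound_def simp flip: exp_add)

text \<open>The passage from ratios to differences: d \<ge> exp(-\<kappa>) c \<ge> (1 - \<kappa>) c
  gives c - d \<le> \<kappa> c \<le> M \<kappa>.\<close>

lemma ratio_bound_abs_diff:
  assumes "ratio_bound \<kappa> a b" "a \<le> M" "b \<le> M" "0 \<le> \<kappa>"
  shows "\<bar>a - b\<bar> \<le> M * \<kappa>"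
proof -
  have *: "c - d \<le> M * \<kappa>" if "0 \<le> c" "c \<le> exp \<kappa> * d" "c \<le> M" for c d
  proof -
    have "exp (-\<kappa>) * c \<le> d" using that by (simp add: exp_minus field_simps)
    moreover have "(1 - \<kappa>) * c \<le> exp (-\<kappa>) * c"
      using exp_ge_add_one_self[of "-\<kappa>"] that by (intro mult_right_mono) auto
    moreover have "\<kappa> * c \<le> \<kappa> * M" using that assms by (intro mult_left_mono) auto
    ultimately show ?thesis by (simp add: algebra_simps)
  qed
  show ?thesis using *[of a b] *[of b a] assms unfolding ratio_bound_def by auto
qed

lemma ratio_bound_ex:
  assumes "finite I" "\<And>i. i \<in> I \<Longrightarrow> 0 < f i \<and> 0 < g i"
  shows "\<exists>\<kappa>\<ge>0. \<forall>i\<in>I. ratio_bound \<kappa> (f i) (g i)"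
proof (intro exI conjI ballI)
  \<comment> \<open>Any common upper bound of the log-ratios serves; the sum also covers an empty
    index set.\<close>
  let ?k = "\<Sum>i\<in>I. \<bar>ln (f i) - ln (g i)\<bar>"
  show "?k \<ge> 0" by (simp add: sum_nonneg)
  fix i assume i: "i \<in> I"
  have "\<bar>ln (f i) - ln (g i)\<bar> \<le> ?k"
    using assms(1) i by (intro member_le_sum) auto
  then have "ratio_bound ?k (exp (ln (f i))) (exp (ln (g i)))" by (rule ratio_bound_exp)
  then show "ratio_bound ?k (f i) (g i)" using assms(2)[OF i] by simp
qed

section \<open>The norms and the normalised duality map\<close>

text \<open>Functions on an arbitrary finite index type let the rows of w and the matrix u, indexed
  by pairs, share one theory.\<close>

definition lp_norm :: "real \<Rightarrow> ('i::finite \<Rightarrow> real) \<Rightarrow> real" where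
  "lp_norm p f = (\<Sum>i\<in>UNIV. \<bar>f i\<bar> powr p) powr (1 / p)"

lemma lp_vec_lp_norm: "lp_vec p v = lp_norm p (\<lambda>i. v $ i)"
  by (simp add: lp_vec_def lp_norm_def)

lemma lp_mat_lp_norm: "lp_mat p M = lp_norm p (\<lambda>(i, j). M $ i $ j)"
  by (simp add: lp_mat_def lp_norm_def sum.cartesian_product case_prod_unfold)

lemma lp_norm_powr: "p > 0 \<Longrightarrow> lp_norm p f powr p = (\<Sum>i\<in>UNIV. \<bar>f i\<bar> powr p)"
  by (simp add: lp_norm_def powr_powr sum_nonneg)

lemma abs_le_lp_norm:
  assumes "p > 0" shows "\<bar>f i\<bar> \<le> lp_norm p f"
proof -
  have "\<bar>f i\<bar> powr p \<le> (\<Sum>i\<in>UNIV. \<bar>f i\<bar> powr p)" by (intro member_le_sum) auto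
  then have "(\<bar>f i\<bar> powr p) powr (1/p) \<le> lp_norm p f"
    unfolding lp_norm_def using assms by (intro powr_mono2) auto
  then show ?thesis using assms by (simp add: powr_powr)
qed

lemma lp_norm_scale:
  assumes "p > 0" shows "lp_norm p (\<lambda>i. c * f i) = \<bar>c\<bar> * lp_norm p f"
proof -
  have "(\<Sum>i\<in>UNIV. \<bar>c * f i\<bar> powr p) = \<bar>c\<bar> powr p * (\<Sum>i\<in>UNIV. \<bar>f i\<bar> powr p)"
    by (simp add: abs_mult powr_mult sum_distrib_left)
  then show ?thesis using assms by (simp add: lp_norm_def powr_mult powr_powr sum_nonneg)
qed

lemma lp_norm_pos:
  assumes "p > 0" "\<And>i. f i > 0" shows "lp_norm p f > 0"
  using abs_le_lp_norm[OF assms(1), of f undefined] assms(2)[of undefined] by linarith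

lemma ratio_bound_lp_norm:
  assumes "p > 0" "\<And>i. ratio_bound \<kappa> (f i) (g i)"
  shows "ratio_bound \<kappa> (lp_norm p f) (lp_norm p g)"
proof -
  have nn: "f i \<ge> 0" "g i \<ge> 0" for i using assms(2)[of i] by (auto simp: ratio_bound_def)
  have "ratio_bound ((1/p) * (p * \<kappa>)) (lp_norm p f) (lp_norm p g)"
    unfolding lp_norm_def using assms nn by (intro ratio_bound_powr ratio_bound_sum) (auto simp: ratio_bound_powr)
  then show ?thesis using assms by simp
qed

lemma lp_norm_fun_upd:
  assumes "p > 0" "f j = 0"
  shows "lp_norm p (f(j := t)) = (lp_norm p f powr p + \<bar>t\<bar> powr p) powr (1 / p)"
proof -
  have "(\<Sum>i\<in>UNIV. \<bar>(f(j := t)) i\<bar> powr p) = \<bar>t\<bar> powr p + (\<Sum>i\<in>UNIV - {j}. \<bar>f i\<bar> powr p)"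
    by (simp add: sum.remove[of _ j])
  also have "(\<Sum>i\<in>UNIV - {j}. \<bar>f i\<bar> powr p) = lp_norm p f powr p"
    using assms by (simp add: lp_norm_powr sum.remove[of UNIV j])
  finally show ?thesis by (simp add: lp_norm_def add.commute)
qed

lemma lp_norm_fun_upd2:
  assumes "p > 0" "k \<noteq> l" "\<bar>s\<bar> powr p + \<bar>t\<bar> powr p = \<bar>f k\<bar> powr p + \<bar>f l\<bar> powr p"
  shows "lp_norm p (f(k := s, l := t)) = lp_norm p f"
proof -
  have *: "(\<Sum>i\<in>UNIV. \<bar>g i\<bar> powr p) =
      \<bar>g k\<bar> powr p + \<bar>g l\<bar> powr p + (\<Sum>i\<in>UNIV - {k} - {l}. \<bar>g i\<bar> powr p)" for g :: "'a \<Rightarrow> real"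
    using assms(2) by (simp add: sum.remove[of UNIV k] sum.remove[of "UNIV - {k}" l])
  have "(\<Sum>i\<in>UNIV. \<bar>(f(k := s, l := t)) i\<bar> powr p) = (\<Sum>i\<in>UNIV. \<bar>f i\<bar> powr p)"
    unfolding *[of f] *[of "f(k := s, l := t)"] using assms by simp
  then show ?thesis by (simp add: lp_norm_def)
qed

text \<open>One block of \<open>G_map\<close> as a function of the partial gradient alone. For
  positive g it is the point of the lp sphere of radius \<rho> at which the linear functional g is
  largest, the equality case of the Hoelder inequality.\<close>

definition normalize_lp :: "real \<Rightarrow> real \<Rightarrow> ('i::finite \<Rightarrow> real) \<Rightarrow> 'i \<Rightarrow> real" where
  "normalize_lp p \<rho> g i = \<rho> / lp_norm p (\<lambda>i. psi (conj_exp p) (g i)) * psi (conj_exp p) (g i)"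

lemma psi_pos_eq: "g > 0 \<Longrightarrow> psi q g = g powr (q - 1)"
  by (simp add: psi_def)

lemma conj_exp_minus_1: "p > 1 \<Longrightarrow> conj_exp p - 1 = 1 / (p - 1)"
  by (simp add: conj_exp_def field_simps)

lemma normalize_lp_pos:
  assumes "p > 1" "\<rho> > 0" "\<And>i. g i > 0" shows "normalize_lp p \<rho> g i > 0"
proof -
  have "psi (conj_exp p) (g i) > 0" for i using assms(3)[of i] by (simp add: psi_pos_eq)
  then show ?thesis unfolding normalize_lp_def using assms
    by (intro mult_pos_pos divide_pos_pos lp_norm_pos) auto
qed

lemma lp_norm_normalize_lp:
  assumes "p > 1" "\<rho> > 0" "\<And>i. g i > 0" shows "lp_norm p (normalize_lp p \<rho> g) = \<rho>"
proof -
  have "psi (conj_exp p) (g i) > 0" for i using assms(3)[of i] by (simp add: psi_pos_eq)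
  then have "lp_norm p (\<lambda>i. psi (conj_exp p) (g i)) > 0" using assms by (intro lp_norm_pos) auto
  then show ?thesis unfolding normalize_lp_def using assms
    by (subst lp_norm_scale) auto
qed

text \<open>The power p' - 1 multiplies \<kappa> by p' - 1. The norm is homogeneous of degree one,
  so it changes by the same ratio as its entries, and the quotient adds the two bounds.\<close>

lemma ratio_bound_normalize_lp:
  assumes "p > 1" "\<rho> > 0" "\<And>i. g i > 0" "\<And>i. h i > 0" "\<And>i. ratio_bound \<kappa> (g i) (h i)"
  shows "ratio_bound (2 * ((conj_exp p - 1) * \<kappa>)) (normalize_lp p \<rho> g i) (normalize_lp p \<rho> h i)"
proof -
  let ?q = "conj_exp p - 1"
  have *: "ratio_bound (?q * \<kappa>) (psi (conj_exp p) (g i)) (psi (conj_exp p) (h i))" for i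
    using ratio_bound_powr[OF assms(5)[of i], of ?q] assms(3)[of i] assms(4)[of i] assms(1)
    by (simp add: psi_pos_eq conj_exp_minus_1)
  have "ratio_bound (?q * \<kappa>) (lp_norm p (\<lambda>i. psi (conj_exp p) (g i))) (lp_norm p (\<lambda>i. psi (conj_exp p) (h i)))"
    using assms(1) * by (intro ratio_bound_lp_norm) auto
  from ratio_bound_const_mult[OF ratio_bound_divide[OF *[of i] this], of \<rho>] assms(2)
  show ?thesis by (simp add: normalize_lp_def algebra_simps)
qed

text \<open>The hypothesis \<open>proportional\<close> is the Lagrange condition that g is a
  multiple of v^(p-1), with the multiplier eliminated. Since p' - 1 = 1/(p - 1), applying
  \<open>psi (conj_exp p)\<close> to g returns a multiple of v, and normalising removes the
  factor.\<close>

lemma normalize_lp_fixed: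
  assumes "p > 1" "\<rho> > 0" "\<And>i. g i > 0" "\<And>i. v i > 0" "lp_norm p v = \<rho>"
    and proportional: "\<And>k l. g l * v k powr (p - 1) = g k * v l powr (p - 1)"
  shows "normalize_lp p \<rho> g i = v i"
proof -
  define c where "c = (g i / v i powr (p - 1)) powr (1 / (p - 1))"
  have c: "c > 0" unfolding c_def using assms(3)[of i] assms(4)[of i] by simp
  have psi: "psi (conj_exp p) (g l) = c * v l" for l
  proof -
    have "g l = g i / v i powr (p - 1) * v l powr (p - 1)"
      using proportional[of i l] assms(4)[of i] by (simp add: field_simps)
    moreover have "psi (conj_exp p) (g l) = g l powr (1 / (p - 1))"
      using assms by (simp add: psi_pos_eq conj_exp_minus_1)
    ultimately show ?thesis unfolding c_def
      using assms(1) assms(3)[of i] assms(4)[of i] assms(4)[of l]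
      by (simp add: powr_mult powr_powr powr_divide)
  qed
  have "lp_norm p (\<lambda>i. psi (conj_exp p) (g i)) = c * \<rho>"
    unfolding psi using assms c by (simp add: lp_norm_scale)
  then show ?thesis using c assms(2) by (simp add: normalize_lp_def psi)
qed

section \<open>First order optimality on an lp sphere\<close>

text \<open>The two coordinates are moved along the curve t \<mapsto> ((a^p + b^p - (b + t)^p)^{1/p}, b + t),
  which keeps the norm fixed; its velocity at 0 is (-(b/a)^{p-1}, 1).\<close>
lemma lagrange_two_coordinates:
  fixes F :: "'a::real_normed_vector \<Rightarrow> real"
  assumes D: "(F has_derivative D) (at z)" and p: "p > 1" and a: "a > 0" and b: "b > 0"
    and le: "\<And>s t. s > 0 \<Longrightarrow> t > 0 \<Longrightarrow> s powr p + t powr p = a powr p + b powr p \<Longrightarrow>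
        F (z + (s - a) *\<^sub>R u + (t - b) *\<^sub>R v) \<le> F z"
  shows "D v * a powr (p - 1) = D u * b powr (p - 1)"
proof -
  define h where "h \<tau> = a powr p + b powr p - (b + \<tau>) powr p" for \<tau>
  define s where "s \<tau> = h \<tau> powr (1 / p)" for \<tau>
  define \<gamma> where "\<gamma> \<tau> = z + (s \<tau> - a) *\<^sub>R u + ((b + \<tau>) - b) *\<^sub>R v" for \<tau>
  let ?m = "- (b powr (p - 1) / a powr (p - 1))"
  have h0: "h 0 = a powr p" by (simp add: h_def)
  have s0: "s 0 = a" unfolding s_def h_def using a p by (simp add: powr_powr)
  have \<gamma>0: "\<gamma> 0 = z" by (simp add: \<gamma>_def s0)
  have h': "(h has_real_derivative - (p * b powr (p - 1))) (at 0)"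
    unfolding h_def using b by (auto intro!: derivative_eq_intros)
  have "(s has_real_derivative (1 / p) * h 0 powr (1 / p - 1) * (- (p * b powr (p - 1)))) (at 0)"
    unfolding s_def using DERIV_fun_powr[OF h', of "1 / p"] h0 a by simp
  moreover have "p * (1 / p - 1) = - (p - 1)" using p by (simp add: field_simps)
  then have "h 0 powr (1 / p - 1) = 1 / a powr (p - 1)"
    unfolding h0 powr_powr by (simp only: powr_minus_divide)
  ultimately have s': "(s has_real_derivative ?m) (at 0)"
    using p by (simp add: field_simps)
  have "(\<gamma> has_derivative (\<lambda>\<tau>. (?m * \<tau>) *\<^sub>R u + \<tau> *\<^sub>R v)) (at 0)"
    unfolding \<gamma>_def using s'[unfolded has_field_derivative_def]
    by (auto intro!: derivative_eq_intros)
  moreover have "(F has_derivative D) (at (\<gamma> 0))" using D by (simp add: \<gamma>0)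
  ultimately have comp: "((\<lambda>\<tau>. F (\<gamma> \<tau>)) has_derivative (\<lambda>\<tau>. D ((?m * \<tau>) *\<^sub>R u + \<tau> *\<^sub>R v))) (at 0)"
    by (rule has_derivative_compose)
  have lin: "linear D" using D by (rule has_derivative_linear)
  have "D ((?m * \<tau>) *\<^sub>R u + \<tau> *\<^sub>R v) = (?m * D u + D v) * \<tau>" for \<tau>
    unfolding linear_add[OF lin] linear_cmul[OF lin] by (simp add: algebra_simps)
  with comp have "((\<lambda>\<tau>. F (\<gamma> \<tau>)) has_real_derivative (?m * D u + D v)) (at 0)"
    by (simp only: has_field_derivative_def)
  \<comment> \<open>The hypothesis \<open>le\<close> compares points with positive coordinates only.
    Near 0 the curve has them: \<open>h\<close> stays positive by continuity, and b + \<tau> > 0 for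
    \<bar>\<tau>\<bar> < b.\<close>
  moreover have "\<exists>d>0. \<forall>\<tau>. \<bar>0 - \<tau>\<bar> < d \<longrightarrow> F (\<gamma> \<tau>) \<le> F (\<gamma> 0)"
  proof -
    have "isCont h 0" using h' DERIV_isCont by blast
    moreover have "h 0 > 0" using a by (simp add: h_def)
    ultimately have "eventually (\<lambda>\<tau>. h \<tau> > 0) (nhds 0)"
      unfolding isCont_def by (metis eventually_nhds_conv_at order_tendstoD(1))
    then obtain d where d: "d > 0" "\<And>\<tau>. \<bar>\<tau>\<bar> < d \<Longrightarrow> h \<tau> > 0"
      unfolding eventually_nhds_metric by (auto simp: dist_real_def)
    have "F (\<gamma> \<tau>) \<le> F z" if "\<bar>\<tau>\<bar> < min d b" for \<tau>
    proof -
      have "h \<tau> > 0" "b + \<tau> > 0" using d that by auto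
      then show ?thesis unfolding \<gamma>_def using p
        by (intro le) (auto simp: s_def powr_powr h_def)
    qed
    then show ?thesis using d b \<gamma>0 by (intro exI[of _ "min d b"]) auto
  qed
  ultimately have "?m * D u + D v = 0" using DERIV_local_max by blast
  then show ?thesis using a by (simp add: field_simps)
qed

text \<open>By ln(1 + r) \<le> r the right-hand side is at most a constant times t^p. Dividing by t
  and letting t tend to 0 forces \<epsilon> \<le> 0, because p > 1.\<close>

lemma sublinear_contradiction:
  fixes p \<rho> \<epsilon> C :: real
  assumes "p > 1" "\<rho> > 0" "\<epsilon> > 0" "C \<ge> 0"
    and "\<And>t. 0 < t \<Longrightarrow> t \<le> 1 \<Longrightarrow> \<epsilon> * t \<le> C * (ln (1 + (t / \<rho>) powr p) / p)"
  shows False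
proof -
  let ?D = "C / (\<rho> powr p * p)"
  have *: "\<epsilon> \<le> ?D * t powr (p - 1)" if "0 < t" "t \<le> 1" for t
  proof -
    have "\<epsilon> * t \<le> C * (ln (1 + (t / \<rho>) powr p) / p)" using assms that by simp
    also have "\<dots> \<le> C * ((t / \<rho>) powr p / p)"
      using assms by (intro mult_left_mono divide_right_mono ln_add_one_self_le_self) auto
    also have "\<dots> = ?D * t powr (p - 1) * t"
      using assms that by (simp add: powr_divide powr_diff)
    finally show ?thesis using that(1) by (rule mult_right_le_imp_le)
  qed
  have "((\<lambda>t. ?D * t powr (p - 1)) \<longlongrightarrow> ?D * 0 powr (p - 1)) (at_right 0)"
    using assms(1) by (intro tendsto_intros) (auto simp: eventually_at_filter)
  then have "((\<lambda>t. ?D * t powr (p - 1)) \<longlongrightarrow> 0) (at_right 0)" by simp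
  moreover have "eventually (\<lambda>t. \<epsilon> \<le> ?D * t powr (p - 1)) (at_right 0)"
    unfolding eventually_at_right_field using * by (intro exI[of _ 1]) auto
  ultimately have "\<epsilon> \<le> 0" by (rule tendsto_lowerbound) simp
  then show False using assms(3) by simp
qed

section \<open>The network and its gradients\<close>

definition preact :: "real^'d^'h \<Rightarrow> real^'d \<Rightarrow> 'h \<Rightarrow> real" where
  "preact u x l = (\<Sum>m\<in>UNIV. u $ l $ m * x $ m)"

lemma net_preact: "net \<alpha> w u x r = (\<Sum>l\<in>UNIV. w $ r $ l * preact u x l powr (\<alpha> $ l))"
  by (simp add: net_def preact_def)

lemma ratio_bound_preact:
  assumes "\<And>m. ratio_bound b (u $ l $ m) (u' $ l $ m)" "\<And>m. x $ m \<ge> 0"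
  shows "ratio_bound b (preact u x l) (preact u' x l)"
  unfolding preact_def
proof (rule ratio_bound_sum)
  fix m
  show "ratio_bound b (u $ l $ m * x $ m) (u' $ l $ m * x $ m)"
    using ratio_bound_const_mult[OF assms(1)[of m] assms(2)[of m]] by (simp add: mult.commute)
qed

lemma preact_nonneg: "(\<And>m. u $ l $ m \<ge> 0) \<Longrightarrow> (\<And>m. x $ m \<ge> 0) \<Longrightarrow> preact u x l \<ge> 0"
  unfolding preact_def by (intro sum_nonneg) auto

lemma preact_le:
  assumes "\<And>m. u $ l $ m \<le> U" "\<And>m. x $ m \<ge> 0" "l1_vec x \<le> X" "U \<ge> 0"
  shows "preact u x l \<le> U * X"
proof -
  have "preact u x l \<le> (\<Sum>m\<in>UNIV. U * x $ m)"
    unfolding preact_def using assms by (intro sum_mono mult_right_mono) auto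
  also have "\<dots> = U * l1_vec x" using assms by (simp add: l1_vec_def sum_distrib_left)
  finally show ?thesis using assms(3,4) by (meson mult_left_mono order_trans)
qed

text \<open>The summand of hidden unit l changes by the ratio exponent a + \<alpha>_l b and is at
  most W (U X)^\<alpha>_l, so \<open>ratio_bound_abs_diff\<close> applies termwise. Summing over l
  separates the coefficients of a and b, which have the shape of \<xi>1 and \<xi>2.\<close>

lemma abs_net_diff_le:
  fixes \<alpha> :: "real^'h::finite"
  assumes w: "\<And>l. ratio_bound a (w $ r $ l) (w' $ r $ l)" "\<And>l. w $ r $ l \<le> W" "\<And>l. w' $ r $ l \<le> W"
    and u: "\<And>l m. ratio_bound b (u $ l $ m) (u' $ l $ m)" "\<And>l m. u $ l $ m \<le> U" "\<And>l m. u' $ l $ m \<le> U"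
    and x: "\<And>m. x $ m \<ge> 0" "l1_vec x \<le> X"
    and nonneg: "a \<ge> 0" "b \<ge> 0" and \<alpha>: "\<And>l. \<alpha> $ l \<ge> 1"
  shows "\<bar>net \<alpha> w u x r - net \<alpha> w' u' x r\<bar>
    \<le> (W * (\<Sum>l\<in>UNIV. (U * X) powr (\<alpha> $ l))) * a + (W * (\<Sum>l\<in>UNIV. \<alpha> $ l * (U * X) powr (\<alpha> $ l))) * b"
proof -
  have nn: "w $ r $ l \<ge> 0" "w' $ r $ l \<ge> 0" "u $ l $ m \<ge> 0" "u' $ l $ m \<ge> 0" for l m
    using w(1)[of l] u(1)[of l m] by (auto simp: ratio_bound_def)
  have U: "U \<ge> 0" using nn(3) u(2) order_trans by blast
  have W: "W \<ge> 0" using nn(1) w(2) order_trans by blast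
  have \<alpha>0: "\<alpha> $ l \<ge> 0" for l using \<alpha>[of l] by simp
  have *: "\<bar>w $ r $ l * preact u x l powr (\<alpha> $ l) - w' $ r $ l * preact u' x l powr (\<alpha> $ l)\<bar>
      \<le> (W * (U * X) powr (\<alpha> $ l)) * (a + \<alpha> $ l * b)" for l
  proof (rule ratio_bound_abs_diff)
    show "ratio_bound (a + \<alpha> $ l * b) (w $ r $ l * preact u x l powr (\<alpha> $ l)) (w' $ r $ l * preact u' x l powr (\<alpha> $ l))"
      using w(1) ratio_bound_preact[OF u(1) x(1)] \<alpha>0[of l] by (intro ratio_bound_mult ratio_bound_powr) auto
    show "w $ r $ l * preact u x l powr (\<alpha> $ l) \<le> W * (U * X) powr (\<alpha> $ l)"
      using preact_le[OF u(2) x U] preact_nonneg[OF nn(3) x(1)] \<alpha>0 w(2) nn W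
      by (intro mult_mono powr_mono2) auto
    show "w' $ r $ l * preact u' x l powr (\<alpha> $ l) \<le> W * (U * X) powr (\<alpha> $ l)"
      using preact_le[OF u(3) x U] preact_nonneg[OF nn(4) x(1)] \<alpha>0 w(3) nn W
      by (intro mult_mono powr_mono2) auto
    show "0 \<le> a + \<alpha> $ l * b" using nonneg \<alpha>0 by simp
  qed
  have "\<bar>net \<alpha> w u x r - net \<alpha> w' u' x r\<bar> \<le> (\<Sum>l\<in>UNIV. (W * (U * X) powr (\<alpha> $ l)) * (a + \<alpha> $ l * b))"
    unfolding net_preact sum_subtractf[symmetric]
    by (rule order_trans[OF sum_abs]) (intro sum_mono *)
  also have "\<dots> = (W * (\<Sum>l\<in>UNIV. (U * X) powr (\<alpha> $ l))) * a + (W * (\<Sum>l\<in>UNIV. \<alpha> $ l * (U * X) powr (\<alpha> $ l))) * b"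
    by (simp add: algebra_simps sum.distrib sum_distrib_left)
  finally show ?thesis .
qed

section \<open>Log-sum-exp score of the network outputs and its derivative\<close>

definition score :: "'k::finite \<Rightarrow> ('k \<Rightarrow> real) \<Rightarrow> real" where
  "score y f = - loss y f + (\<Sum>r\<in>UNIV. f r)"

text \<open>The summand 1 comes from the sum of all outputs in the objective. It outweighs the
  softmax weight, which is at most 1, and so makes every partial derivative nonnegative.\<close>

definition score_deriv :: "'k::finite \<Rightarrow> ('k \<Rightarrow> real) \<Rightarrow> 'k \<Rightarrow> real" where
  "score_deriv y f r = (if r = y then 1 else 0) + 1 - exp (f r) / (\<Sum>j\<in>UNIV. exp (f j))"

lemma sum_exp_pos: "0 < (\<Sum>j\<in>(UNIV::'k::finite set). exp (f j :: real))"
  by (intro sum_pos) auto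

lemma score_deriv_eq:
  "score_deriv y f r = (if r = y then 1 else 0) + (\<Sum>j\<in>UNIV - {r}. exp (f j)) / (\<Sum>j\<in>UNIV. exp (f j))"
proof -
  have "(\<Sum>j\<in>UNIV. exp (f j)) = exp (f r) + (\<Sum>j\<in>UNIV - {r}. exp (f j))"
    by (simp add: sum.remove)
  with sum_exp_pos[of f] show ?thesis by (simp add: score_deriv_def field_simps)
qed

lemma score_deriv_nonneg: "score_deriv y f r \<ge> 0"
  unfolding score_deriv_eq by (auto intro!: sum_nonneg divide_nonneg_nonneg add_nonneg_nonneg)

text \<open>The complement form of the softmax term is a quotient of sums of positive terms, so no
  cancellation spoils the multiplicative comparison.\<close>
lemma ratio_bound_score_deriv:
  assumes "\<And>j. \<bar>f j - g j\<bar> \<le> \<eta>"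
  shows "ratio_bound (2 * \<eta>) (score_deriv y f r) (score_deriv y g r)"
proof -
  have "\<eta> \<ge> 0" using assms[of undefined] by linarith
  moreover have "ratio_bound (\<eta> + \<eta>) ((\<Sum>j\<in>UNIV - {r}. exp (f j)) / (\<Sum>j\<in>UNIV. exp (f j)))
      ((\<Sum>j\<in>UNIV - {r}. exp (g j)) / (\<Sum>j\<in>UNIV. exp (g j)))"
    by (intro ratio_bound_divide ratio_bound_sum ratio_bound_exp assms)
  ultimately show ?thesis unfolding score_deriv_eq by (intro ratio_bound_add ratio_bound_refl) auto
qed

text \<open>Raising the outputs by a total of D raises the log-sum-exp by at most D, which the sum
  of the outputs pays for, while the output of class y only grows. The argument avoids derivatives,
  so it is available at boundary points.\<close>

lemma score_mono:
  assumes "\<And>j. f j \<le> g j" shows "score y f \<le> score y g"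
proof -
  let ?D = "\<Sum>j\<in>UNIV. g j - f j"
  have "g j - f j \<le> ?D" for j using assms by (intro member_le_sum) auto
  then have "exp (g j) \<le> exp ?D * exp (f j)" for j
    unfolding exp_add[symmetric] exp_le_cancel_iff by (simp add: algebra_simps)
  then have "(\<Sum>j\<in>UNIV. exp (g j)) \<le> exp ?D * (\<Sum>j\<in>UNIV. exp (f j))"
    unfolding sum_distrib_left by (intro sum_mono)
  then have "ln (\<Sum>j\<in>UNIV. exp (g j)) \<le> ln (exp ?D * (\<Sum>j\<in>UNIV. exp (f j)))"
    using sum_exp_pos[of g] sum_exp_pos[of f] by simp
  also have "\<dots> = ?D + ln (\<Sum>j\<in>UNIV. exp (f j))"
    using sum_exp_pos[of f] by (simp add: ln_mult)
  finally show ?thesis using assms[of y] by (simp add: score_def loss_def sum_subtractf)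
qed

text \<open>In 2 + K, the output of class y and the log-sum-exp contribute \<eta> each, and the sum
  of the K outputs contributes K \<eta>.\<close>

lemma score_diff_le:
  fixes f g :: "'k::finite \<Rightarrow> real"
  assumes "\<And>j. \<bar>f j - g j\<bar> \<le> \<eta>"
  shows "score y f - score y g \<le> (2 + real CARD('k)) * \<eta>"
proof -
  have "exp (g j) \<le> exp \<eta> * exp (f j)" for j
    unfolding exp_add[symmetric] exp_le_cancel_iff using assms[of j] by (simp add: algebra_simps)
  then have "(\<Sum>j\<in>UNIV. exp (g j)) \<le> exp \<eta> * (\<Sum>j\<in>UNIV. exp (f j))"
    unfolding sum_distrib_left by (intro sum_mono)
  then have "ln (\<Sum>j\<in>UNIV. exp (g j)) \<le> ln (exp \<eta> * (\<Sum>j\<in>UNIV. exp (f j)))"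
    using sum_exp_pos[of g] sum_exp_pos[of f] by simp
  also have "\<dots> = \<eta> + ln (\<Sum>j\<in>UNIV. exp (f j))"
    using sum_exp_pos[of f] by (simp add: ln_mult)
  finally have "ln (\<Sum>j\<in>UNIV. exp (g j)) - ln (\<Sum>j\<in>UNIV. exp (f j)) \<le> \<eta>" by simp
  moreover have "(\<Sum>j\<in>UNIV. f j - g j) \<le> (\<Sum>j\<in>(UNIV::'k set). \<eta>)"
    by (intro sum_mono) (metis abs_le_D1 assms)
  moreover have "f y - g y \<le> \<eta>" using assms[of y] by simp
  ultimately show ?thesis by (simp add: score_def loss_def sum_subtractf algebra_simps)
qed

lemma has_derivative_score:
  assumes "\<And>r. ((\<lambda>z. f z r) has_derivative (\<lambda>h. D h r)) (at z)"
  shows "((\<lambda>z. score y (f z)) has_derivative (\<lambda>h. \<Sum>r\<in>UNIV. score_deriv y (f z) r * D h r)) (at z)"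
proof -
  let ?S = "\<Sum>j\<in>UNIV. exp (f z j)"
  have "((\<lambda>z. exp (f z j)) has_derivative (\<lambda>h. exp (f z j) * D h j)) (at z)" for j
    using DERIV_compose_FDERIV[OF DERIV_exp assms[of j]] by (simp add: mult.commute)
  then have "((\<lambda>z. \<Sum>j\<in>UNIV. exp (f z j)) has_derivative (\<lambda>h. \<Sum>j\<in>UNIV. exp (f z j) * D h j)) (at z)"
    by (intro has_derivative_sum)
  from DERIV_compose_FDERIV[OF DERIV_ln_divide[OF sum_exp_pos] this]
  have "((\<lambda>z. ln (\<Sum>j\<in>UNIV. exp (f z j))) has_derivative
      (\<lambda>h. (\<Sum>j\<in>UNIV. exp (f z j) * D h j) * (1 / ?S))) (at z)" .
  from has_derivative_add[OF has_derivative_minus[OF has_derivative_add[OF has_derivative_minus[OF assms[of y]] this]]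
      has_derivative_sum[of UNIV "\<lambda>r z. f z r", OF assms]]
  have "((\<lambda>z. score y (f z)) has_derivative
      (\<lambda>h. - (- D h y + (\<Sum>j\<in>UNIV. exp (f z j) * D h j) * (1 / ?S)) + (\<Sum>r\<in>UNIV. D h r))) (at z)"
    by (simp add: score_def loss_def)
  then show ?thesis
  proof (rule has_derivative_eq_rhs, intro ext)
    fix h
    have "(\<Sum>r\<in>UNIV. score_deriv y (f z) r * D h r)
        = (\<Sum>r\<in>UNIV. (if r = y then D h r else 0) + D h r - exp (f z r) * D h r * (1 / ?S))"
      by (intro sum.cong) (auto simp: score_deriv_def algebra_simps)
    also have "\<dots> = - (- D h y + (\<Sum>j\<in>UNIV. exp (f z j) * D h j) * (1 / ?S)) + (\<Sum>r\<in>UNIV. D h r)"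
      by (simp add: sum_subtractf sum.distrib sum_distrib_right sum_divide_distrib)
    finally show "- (- D h y + (\<Sum>j\<in>UNIV. exp (f z j) * D h j) * (1 / ?S)) + (\<Sum>r\<in>UNIV. D h r)
        = (\<Sum>r\<in>UNIV. score_deriv y (f z) r * D h r)" by simp
  qed
qed

section \<open>Derivatives of the network and of the objective\<close>

lemma has_derivative_net:
  fixes z :: "(real^'h::finite^'k::finite) \<times> (real^'d::finite^'h)"
  assumes u: "\<And>l m. snd z $ l $ m > 0" and x: "\<And>m. x $ m \<ge> 0"
  shows "((\<lambda>z. net \<alpha> (fst z) (snd z) x r) has_derivative
    (\<lambda>h. \<Sum>l\<in>UNIV. fst h $ r $ l * preact (snd z) x l powr (\<alpha> $ l)
       + fst z $ r $ l * (\<alpha> $ l * preact (snd z) x l powr (\<alpha> $ l - 1) * preact (snd h) x l))) (at z)"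
proof -
  have w': "((\<lambda>z::(real^'h^'k) \<times> (real^'d^'h). fst z $ r $ l) has_derivative (\<lambda>h. fst h $ r $ l)) (at z)" for l
    by (intro linear_imp_has_derivative linearI) auto
  have p': "((\<lambda>z::(real^'h^'k) \<times> (real^'d^'h). preact (snd z) x l) has_derivative (\<lambda>h. preact (snd h) x l)) (at z)" for l
    by (intro linear_imp_has_derivative linearI)
       (auto simp: preact_def algebra_simps sum.distrib sum_distrib_left)
  have P': "((\<lambda>z::(real^'h^'k) \<times> (real^'d^'h). preact (snd z) x l powr (\<alpha> $ l)) has_derivative
      (\<lambda>h. \<alpha> $ l * preact (snd z) x l powr (\<alpha> $ l - 1) * preact (snd h) x l)) (at z)" for l
  \<comment> \<open>For x = 0 the preactivation vanishes identically, so the function and its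
    claimed derivative are both zero. Otherwise positive weights make the preactivation positive,
    where \<open>powr\<close> is differentiable.\<close>
  proof (cases "x = 0")
    case True
    then show ?thesis by (simp add: preact_def)
  next
    case False
    then obtain m where "x $ m \<noteq> 0" by (auto simp: Finite_Cartesian_Product.vec_eq_iff)
    with x[of m] have "x $ m > 0" by simp
    moreover have "snd z $ l $ m * x $ m \<le> preact (snd z) x l"
      unfolding preact_def using u x by (intro member_le_sum) (auto intro: less_imp_le mult_nonneg_nonneg)
    ultimately have "preact (snd z) x l > 0" using u[of l m] by (smt (verit) mult_pos_pos)
    from DERIV_compose_FDERIV[OF has_real_derivative_powr[OF this] p']
    show ?thesis by (simp add: mult_ac)
  qed
  show ?thesis unfolding net_preact
    by (rule has_derivative_eq_rhs, rule has_derivative_sum, rule has_derivative_mult[OF w' P'])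
       (auto simp: algebra_simps)
qed

definition Phi_grad_w :: "('n::finite \<Rightarrow> real^'d) \<Rightarrow> ('n \<Rightarrow> 'k::finite) \<Rightarrow> real^'h \<Rightarrow> real
    \<Rightarrow> (real^'h^'k) \<times> (real^'d^'h) \<Rightarrow> 'k \<Rightarrow> 'h \<Rightarrow> real" where
  "Phi_grad_w x y \<alpha> \<epsilon> z r l = (1 / real CARD('n)) *
     (\<Sum>i\<in>UNIV. score_deriv (y i) (net \<alpha> (fst z) (snd z) (x i)) r * preact (snd z) (x i) l powr (\<alpha> $ l)) + \<epsilon>"

text \<open>The convention \<open>0 powr 0 = 0\<close> is harmless for \<alpha>_l = 1: with positive
  u and nonnegative data, a vanishing preactivation forces the data point to be zero, and the factor
  \<open>x i $ m\<close> vanishes as well.\<close>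

definition Phi_grad_u :: "('n::finite \<Rightarrow> real^'d) \<Rightarrow> ('n \<Rightarrow> 'k::finite) \<Rightarrow> real^'h \<Rightarrow> real
    \<Rightarrow> (real^'h^'k) \<times> (real^'d^'h) \<Rightarrow> 'h \<Rightarrow> 'd \<Rightarrow> real" where
  "Phi_grad_u x y \<alpha> \<epsilon> z l m = (1 / real CARD('n)) *
     (\<Sum>i\<in>UNIV. \<Sum>r\<in>UNIV. score_deriv (y i) (net \<alpha> (fst z) (snd z) (x i)) r *
        (fst z $ r $ l * (\<alpha> $ l * preact (snd z) (x i) l powr (\<alpha> $ l - 1) * x i $ m))) + \<epsilon>"

lemma Phi_eq:
  "Phi x y \<alpha> \<epsilon> z = (1 / real CARD('n)) * (\<Sum>i\<in>UNIV. score (y i) (net \<alpha> (fst z) (snd z) (x i)))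
     + \<epsilon> * ((\<Sum>r\<in>UNIV. \<Sum>l\<in>UNIV. fst z $ r $ l) + (\<Sum>l\<in>UNIV. \<Sum>m\<in>UNIV. snd z $ l $ m))"
  for x :: "'n::finite \<Rightarrow> real^'d"
  by (simp add: Phi_def score_def case_prod_unfold)

lemma has_derivative_Phi:
  fixes x :: "'n::finite \<Rightarrow> real^'d::finite" and y :: "'n \<Rightarrow> 'k::finite" and \<alpha> :: "real^'h::finite"
  assumes u: "\<And>l m. snd z $ l $ m > 0" and x: "\<And>i m. x i $ m \<ge> 0"
  shows "(Phi x y \<alpha> \<epsilon> has_derivative
    (\<lambda>h. (1 / real CARD('n)) * (\<Sum>i\<in>UNIV. \<Sum>r\<in>UNIV. score_deriv (y i) (net \<alpha> (fst z) (snd z) (x i)) r *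
        (\<Sum>l\<in>UNIV. fst h $ r $ l * preact (snd z) (x i) l powr (\<alpha> $ l)
          + fst z $ r $ l * (\<alpha> $ l * preact (snd z) (x i) l powr (\<alpha> $ l - 1) * preact (snd h) (x i) l)))
      + \<epsilon> * ((\<Sum>r\<in>UNIV. \<Sum>l\<in>UNIV. fst h $ r $ l) + (\<Sum>l\<in>UNIV. \<Sum>m\<in>UNIV. snd h $ l $ m)))) (at z)"
proof -
  let ?L = "\<lambda>h::(real^'h^'k) \<times> (real^'d^'h).
    (\<Sum>r\<in>UNIV. \<Sum>l\<in>UNIV. fst h $ r $ l) + (\<Sum>l\<in>UNIV. \<Sum>m\<in>UNIV. snd h $ l $ m)"
  have L: "(?L has_derivative ?L) (at z)"
    by (intro linear_imp_has_derivative linearI)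
       (auto simp: sum.distrib sum_distrib_left algebra_simps)
  show ?thesis unfolding Phi_eq[abs_def]
    by (intro has_derivative_add[OF _ has_derivative_mult_right[OF L]] has_derivative_mult_right
        has_derivative_sum has_derivative_score has_derivative_net u x)
qed

lemma axis_axis_nth: "axis r (axis l (1::real)) $ r' $ l' = (if l' = l then if r' = r then 1 else 0 else 0)"
  by (simp add: axis_def)

lemma grad_w_Phi:
  fixes x :: "'n::finite \<Rightarrow> real^'d::finite" and y :: "'n \<Rightarrow> 'k::finite" and \<alpha> :: "real^'h::finite"
  assumes u: "\<And>l m. snd z $ l $ m > 0" and x: "\<And>i m. x i $ m \<ge> 0"
  shows "grad_w (Phi x y \<alpha> \<epsilon>) z r $ l = Phi_grad_w x y \<alpha> \<epsilon> z r l"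
  unfolding grad_w_def vec_lambda_beta frechet_derivative_at[OF has_derivative_Phi[OF u x], symmetric]
  by (simp add: Phi_grad_w_def axis_axis_nth preact_def if_distrib[where f="\<lambda>a. a * _"]
      if_distrib[where f="\<lambda>a. _ * a"] sum.delta cong: if_cong)

lemma grad_u_Phi:
  fixes x :: "'n::finite \<Rightarrow> real^'d::finite" and y :: "'n \<Rightarrow> 'k::finite" and \<alpha> :: "real^'h::finite"
  assumes u: "\<And>l m. snd z $ l $ m > 0" and x: "\<And>i m. x i $ m \<ge> 0"
  shows "grad_u (Phi x y \<alpha> \<epsilon>) z $ l $ m = Phi_grad_u x y \<alpha> \<epsilon> z l m"
proof -
  have "preact (axis l (axis m 1)) v l' = (if l' = l then v $ m else 0)" for v l'
    by (simp add: preact_def axis_def if_distrib[where f="\<lambda>a. a * _"] sum.delta cong: if_cong)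
  then show ?thesis
    unfolding grad_u_def vec_lambda_beta frechet_derivative_at[OF has_derivative_Phi[OF u x], symmetric]
    by (simp add: Phi_grad_u_def axis_axis_nth if_distrib[where f="\<lambda>a. a * _"]
      if_distrib[where f="\<lambda>a. _ * a"] sum.delta cong: if_cong)
qed

section \<open>Perron eigenvalue of a block-constant matrix\<close>

text \<open>\<mu> is the larger root of the characteristic polynomial and (b, \<mu> - a) its
  eigenvector. Positivity of b c gives \<mu> > a, hence a positive second entry; the second equation
  is (\<mu> - a)(\<mu> - d) = b c.\<close>

lemma perron_2x2:
  fixes a b c d :: real
  assumes "a \<ge> 0" "b > 0" "c > 0" "d \<ge> 0"
  obtains \<mu> s t where "\<mu> > 0" "s > 0" "t > 0" "a * s + b * t = \<mu> * s" "c * s + d * t = \<mu> * t"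
proof -
  let ?q = "sqrt ((a - d)^2 + 4 * (b * c))"
  define \<mu> where "\<mu> = ((a + d) + ?q) / 2"
  have bc: "b * c > 0" using assms by simp
  have q2: "?q^2 = (a - d)^2 + 4 * (b * c)" using bc by simp
  have "\<bar>a - d\<bar> < ?q" using bc by (intro real_less_rsqrt) simp
  then have \<mu>: "\<mu> > a" unfolding \<mu>_def by (simp add: field_simps)
  have eq: "(\<mu> - a) * (\<mu> - d) = b * c"
    using q2 unfolding \<mu>_def by (simp add: field_simps power2_eq_square)
  show thesis
  proof (rule that[of \<mu> b "\<mu> - a"])
    show "c * b + d * (\<mu> - a) = \<mu> * (\<mu> - a)" using eq by (simp add: algebra_simps)
  qed (use \<mu> assms in \<open>auto simp: algebra_simps\<close>)
qed

text \<open>The eigenvector is (s, ..., s, t), which reduces the matrix to a 2 by 2 one.\<close>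
lemma block_constant_eigenvalue_le_spectral_radius:
  fixes a b c d s t \<mu> :: real
  assumes A: "A = Matrix.mat (K + 1) (K + 1) (\<lambda>(i, j).
      if i < K \<and> j < K then a else if i < K then b else if j < K then c else d)"
    and eq: "real K * a * s + b * t = \<mu> * s" "real K * c * s + d * t = \<mu> * t" and t: "t > 0"
  shows "\<mu> \<le> spectral_radius (map_mat complex_of_real A)"
proof -
  let ?A = "map_mat complex_of_real A"
  let ?v = "Matrix.vec (K + 1) (\<lambda>i. complex_of_real (if i < K then s else t))"
  have carr: "?A \<in> carrier_mat (K + 1) (K + 1)" by (simp add: A)
  have "?A *\<^sub>v ?v = complex_of_real \<mu> \<cdot>\<^sub>v ?v"
  proof (rule eq_vecI)
    fix i assume "i < dim_vec (complex_of_real \<mu> \<cdot>\<^sub>v ?v)"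
    then have i: "i < K + 1" by simp
    define g where "g j = (if i < K \<and> j < K then a else if i < K then b else if j < K then c else d)
      * (if j < K then s else t)" for j
    have "vec_index (?A *\<^sub>v ?v) i = complex_of_real (\<Sum>j\<in>{0..<K+1}. g j)"
      using i by (simp add: A scalar_prod_def g_def)
    also have "(\<Sum>j\<in>{0..<K+1}. g j) = (\<Sum>j\<in>{0..<K}. g j) + g K" by simp
    also have "(\<Sum>j\<in>{0..<K}. g j) = (\<Sum>j\<in>{0..<K}. (if i < K then a else c) * s)"
      by (intro sum.cong) (auto simp: g_def)
    also have "(\<Sum>j\<in>{0..<K}. (if i < K then a else c) * s) + g K = \<mu> * (if i < K then s else t)"
      using eq by (auto simp: g_def algebra_simps)
    finally show "vec_index (?A *\<^sub>v ?v) i = vec_index (complex_of_real \<mu> \<cdot>\<^sub>v ?v) i"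
      using i by simp
  qed (simp add: A)
  moreover have "?v \<noteq> 0\<^sub>v (K + 1)"
  proof
    assume "?v = 0\<^sub>v (K + 1)"
    then have "vec_index ?v K = vec_index (0\<^sub>v (K + 1)) K" by simp
    then show False using t by simp
  qed
  ultimately have "eigenvalue ?A (complex_of_real \<mu>)"
    unfolding eigenvalue_def eigenvector_def using carr by (intro exI[of _ ?v]) (simp add: A)
  then have "complex_of_real \<mu> \<in> spectrum ?A" by (simp add: spectrum_def)
  then have "norm (complex_of_real \<mu>) \<in> norm ` spectrum ?A" by (rule imageI)
  from spectral_radius_mem_max(2)[OF carr _ this]
  have "norm (complex_of_real \<mu>) \<le> spectral_radius ?A"
    by simp
  then show ?thesis by simp
qed

section \<open>The constraint set\<close>

lemma ratio_bound_exp_scale: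
  assumes "0 \<le> \<kappa>" "0 \<le> v" shows "ratio_bound \<kappa> v (exp (- \<kappa>) * v)"
proof -
  have "exp (- \<kappa>) * v \<le> 1 * v" using assms by (intro mult_right_mono) auto
  moreover have "1 * v \<le> exp \<kappa> * v" using assms by (intro mult_right_mono) auto
  ultimately have "exp (- \<kappa>) * v \<le> exp \<kappa> * v" by linarith
  moreover have "exp \<kappa> * (exp (- \<kappa>) * v) = v" by (simp add: exp_minus)
  ultimately show ?thesis using assms unfolding ratio_bound_def by (metis exp_ge_zero mult_nonneg_nonneg order_refl)
qed

text \<open>Filling a zero coordinate with t turns \<rho>^p into \<rho>^p (1 + (t/\<rho>)^p), so the
  norm becomes \<rho> exp \<kappa>, and the factor exp(-\<kappa>) leads back to the sphere.\<close>

lemma lp_norm_bump: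
  assumes "p > 1" "\<rho> > 0" "lp_norm p f = \<rho>" "f j = 0" "t > 0"
    and \<kappa>: "\<kappa> = ln (1 + (t / \<rho>) powr p) / p"
  shows "lp_norm p (\<lambda>i. exp (- \<kappa>) * (f(j := t)) i) = \<rho>"
proof -
  have pos: "1 + (t / \<rho>) powr p > 0" by (intro add_pos_nonneg) auto
  have "exp \<kappa> = (1 + (t / \<rho>) powr p) powr (1 / p)"
    using pos by (simp add: \<kappa> powr_def[of "1 + (t / \<rho>) powr p"])
  moreover have "lp_norm p (f(j := t)) = (\<rho> powr p * (1 + (t / \<rho>) powr p)) powr (1 / p)"
    using assms by (simp add: lp_norm_fun_upd powr_divide distrib_left)
  ultimately have "lp_norm p (f(j := t)) = \<rho> * exp \<kappa>"
    using assms by (simp add: powr_mult powr_powr)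
  then show ?thesis using assms by (subst lp_norm_scale) (auto simp: exp_minus)
qed

lemma continuous_on_lp_norm:
  assumes "p > 0" "\<And>i. continuous_on S (\<lambda>z. f z i)"
  shows "continuous_on S (\<lambda>z. lp_norm p (f z))"
  unfolding lp_norm_def using assms
  by (intro continuous_on_powr' continuous_intros) (auto intro!: sum_nonneg)

text \<open>All rows of w share the radius a because the first K rows of the matrix A coincide; u
  has its own radius b.\<close>

definition ratio_close :: "real \<Rightarrow> real \<Rightarrow> (real^'h^'k) \<times> (real^'d^'h) \<Rightarrow> (real^'h^'k) \<times> (real^'d^'h) \<Rightarrow> bool" where
  "ratio_close a b z z' \<longleftrightarrow> (\<forall>r l. ratio_bound a (fst z $ r $ l) (fst z' $ r $ l)) \<and> (\<forall>l m. ratio_bound b (snd z $ l $ m) (snd z' $ l $ m))"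

lemma mem_S_plus: "z \<in> S_plus pw pu \<rho>w \<rho>u \<longleftrightarrow>
    (\<forall>r l. fst z $ r $ l \<ge> 0) \<and> (\<forall>l m. snd z $ l $ m \<ge> 0)
    \<and> lp_norm pu (\<lambda>(l, m). snd z $ l $ m) = \<rho>u \<and> (\<forall>r. lp_norm pw (\<lambda>l. fst z $ r $ l) = \<rho>w)"
  by (simp add: S_plus_def lp_vec_lp_norm lp_mat_lp_norm case_prod_unfold)

lemma mem_S_pplus: "z \<in> S_pplus pw pu \<rho>w \<rho>u \<longleftrightarrow>
    (\<forall>r l. fst z $ r $ l > 0) \<and> (\<forall>l m. snd z $ l $ m > 0)
    \<and> lp_norm pu (\<lambda>(l, m). snd z $ l $ m) = \<rho>u \<and> (\<forall>r. lp_norm pw (\<lambda>l. fst z $ r $ l) = \<rho>w)"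
  by (simp add: S_pplus_def lp_vec_lp_norm lp_mat_lp_norm case_prod_unfold)

lemma S_pplus_subset: "S_pplus pw pu \<rho>w \<rho>u \<subseteq> S_plus pw pu \<rho>w \<rho>u"
  by (auto simp: mem_S_plus mem_S_pplus less_imp_le)

lemma S_plus_le:
  assumes "z \<in> S_plus pw pu \<rho>w \<rho>u" "pw > 0" "pu > 0"
  shows "fst z $ r $ l \<le> \<rho>w" "snd z $ l $ m \<le> \<rho>u"
  using abs_le_lp_norm[OF assms(2), of "\<lambda>l. fst z $ r $ l" l]
    abs_le_lp_norm[OF assms(3), of "\<lambda>(l, m). snd z $ l $ m" "(l, m)"] assms(1)
  by (auto simp: mem_S_plus)

lemma compact_S_plus:
  assumes "pw > 0" "pu > 0"
  shows "compact (S_plus pw pu \<rho>w \<rho>u :: ((real^'h::finite^'k::finite) \<times> (real^'d::finite^'h)) set)"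
  unfolding compact_eq_bounded_closed
proof
  have nrm: "norm v \<le> real CARD('i) * real CARD('j) * c" if "\<And>i j. \<bar>v $ i $ j\<bar> \<le> c"
    for v :: "real^'j::finite^'i::finite" and c
  proof -
    have "norm v \<le> (\<Sum>i\<in>UNIV. norm (v $ i))" by (simp add: norm_vec_def L2_set_le_sum)
    also have "\<dots> \<le> (\<Sum>i\<in>UNIV. \<Sum>j\<in>UNIV. \<bar>v $ i $ j\<bar>)" by (intro sum_mono norm_le_l1_cart)
    also have "\<dots> \<le> (\<Sum>i\<in>(UNIV::'i set). \<Sum>j\<in>(UNIV::'j set). c)" by (intro sum_mono that)
    finally show ?thesis by simp
  qed
  show "bounded (S_plus pw pu \<rho>w \<rho>u :: ((real^'h^'k) \<times> (real^'d^'h)) set)"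
  proof (rule boundedI)
    fix z :: "(real^'h^'k) \<times> (real^'d^'h)" assume z: "z \<in> S_plus pw pu \<rho>w \<rho>u"
    then have "\<bar>fst z $ r $ l\<bar> \<le> \<rho>w" "\<bar>snd z $ l $ m\<bar> \<le> \<rho>u" for r l m
      using S_plus_le[OF z assms] by (auto simp: mem_S_plus)
    then have "norm (fst z) \<le> real CARD('k) * real CARD('h) * \<rho>w" "norm (snd z) \<le> real CARD('h) * real CARD('d) * \<rho>u"
      by (auto intro: nrm)
    then show "norm z \<le> real CARD('k) * real CARD('h) * \<rho>w + real CARD('h) * real CARD('d) * \<rho>u"
      using norm_Pair_le[of "fst z" "snd z"] by simp
  qed
  have "S_plus pw pu \<rho>w \<rho>u = {z :: (real^'h^'k) \<times> (real^'d^'h). (\<forall>r l. 0 \<le> fst z $ r $ l) \<and> (\<forall>l m. 0 \<le> snd z $ l $ m)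
    \<and> lp_norm pu (\<lambda>i. snd z $ fst i $ snd i) = \<rho>u \<and> (\<forall>r. lp_norm pw (\<lambda>l. fst z $ r $ l) = \<rho>w)}"
    by (auto simp: mem_S_plus case_prod_unfold)
  also have "closed \<dots>"
    using assms by (intro closed_Collect_conj closed_Collect_all closed_Collect_le closed_Collect_eq
      continuous_on_lp_norm continuous_intros)
  finally show "closed (S_plus pw pu \<rho>w \<rho>u :: ((real^'h^'k) \<times> (real^'d^'h)) set)" .
qed

lemma lp_norm_const:
  fixes \<rho> p :: real
  assumes "p > 0" "\<rho> > 0"
  shows "lp_norm p (\<lambda>i::'i::finite. \<rho> / lp_norm p (\<lambda>i::'i. 1)) = \<rho>" "\<rho> / lp_norm p (\<lambda>i::'i. 1) > 0"
  using lp_norm_pos[of p "\<lambda>i::'i. 1"] lp_norm_scale[of p "\<rho> / lp_norm p (\<lambda>i::'i. 1)" "\<lambda>i::'i. 1"] assms by simp_all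

lemma S_plus_nonempty:
  assumes "pw > 0" "pu > 0" "\<rho>w > 0" "\<rho>u > 0"
  shows "(S_plus pw pu \<rho>w \<rho>u :: ((real^'h::finite^'k::finite) \<times> (real^'d::finite^'h)) set) \<noteq> {}"
proof -
  have "((\<chi> r l. \<rho>w / lp_norm pw (\<lambda>i::'h. 1)), (\<chi> l m. \<rho>u / lp_norm pu (\<lambda>i::'h \<times> 'd. 1))) \<in>
      (S_plus pw pu \<rho>w \<rho>u :: ((real^'h^'k) \<times> (real^'d^'h)) set)"
    using lp_norm_const[OF assms(1,3), where 'i='h] lp_norm_const[OF assms(2,4), where 'i="'h \<times> 'd"]
    by (simp add: mem_S_plus case_prod_unfold less_imp_le)
  then show ?thesis by blast
qed

text \<open>On the boundary of the feasible set a preactivation may vanish; a positive exponent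
  keeps \<open>powr\<close> continuous there, which suffices for the existence of a
  maximizer.\<close>

lemma continuous_on_Phi:
  fixes x :: "'n::finite \<Rightarrow> real^'d::finite" and y :: "'n \<Rightarrow> 'k::finite" and \<alpha> :: "real^'h::finite"
  assumes \<alpha>: "\<And>l. \<alpha> $ l \<ge> 1" and x: "\<And>i m. x i $ m \<ge> 0"
  shows "continuous_on (S_plus pw pu \<rho>w \<rho>u) (Phi x y \<alpha> \<epsilon>)"
proof -
  have net: "continuous_on (S_plus pw pu \<rho>w \<rho>u) (\<lambda>z::(real^'h^'k) \<times> (real^'d^'h). net \<alpha> (fst z) (snd z) (x i) r)" for i r
    unfolding net_preact
  proof (intro continuous_on_sum continuous_on_mult continuous_on_powr' ballI conjI impI)
    fix z :: "(real^'h^'k) \<times> (real^'d^'h)" and i l assume z: "z \<in> S_plus pw pu \<rho>w \<rho>u"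
    show "0 \<le> preact (snd z) (x i) l" using z x by (intro preact_nonneg) (auto simp: mem_S_plus)
    show "0 < \<alpha> $ l" using \<alpha>[of l] by simp
  next
    fix i l show "continuous_on (S_plus pw pu \<rho>w \<rho>u) (\<lambda>z::(real^'h^'k) \<times> (real^'d^'h). preact (snd z) (x i) l)"
      unfolding preact_def by (intro continuous_intros)
  qed (intro continuous_intros)+
  have nz: "(\<Sum>j\<in>UNIV. exp (f j :: real)) \<noteq> 0" for f :: "'k \<Rightarrow> real"
    using sum_exp_pos[of f] by simp
  show ?thesis
    unfolding Phi_eq[abs_def] score_def loss_def
    by (intro continuous_intros net) (simp add: nz)
qed

section \<open>The fixed point map as a contraction\<close>

lemma vec_nth_vec_lambda: "vec_nth (vec_lambda f) = f"
  by auto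

locale network_problem =
  fixes x :: "'n::finite \<Rightarrow> real^'d::finite"
    and y :: "'n \<Rightarrow> 'k::finite"
    and \<alpha> :: "real^'h::finite"
    and pw pu \<rho>w \<rho>u \<epsilon> :: real
  assumes x_nonneg: "\<And>i m. x i $ m \<ge> 0"
    and pw: "1 < pw" and pu: "1 < pu"
    and \<rho>w: "\<rho>w > 0" and \<rho>u: "\<rho>u > 0"
    and \<epsilon>: "\<epsilon> > 0"
    and \<alpha>_ge: "\<And>l. \<alpha> $ l \<ge> 1"
begin

abbreviation \<Phi> :: "(real^'h^'k) \<times> (real^'d^'h) \<Rightarrow> real" where "\<Phi> \<equiv> Phi x y \<alpha> \<epsilon>"
abbreviation G where "G \<equiv> G_map pw pu \<rho>w \<rho>u \<Phi>"
abbreviation Sp :: "((real^'h^'k) \<times> (real^'d^'h)) set" where "Sp \<equiv> S_plus pw pu \<rho>w \<rho>u"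
abbreviation Spp :: "((real^'h^'k) \<times> (real^'d^'h)) set" where "Spp \<equiv> S_pplus pw pu \<rho>w \<rho>u"

section \<open>Constants of the problem and additive estimates for the objective\<close>

definition \<rho>x :: real where "\<rho>x = Max (range (\<lambda>i. l1_vec (x i)))"
text \<open>The entry bounds are parameters: \<rho>w and \<rho>u give the constant \<xi>1 of the
  theorem, whereas the perturbed points in the positivity argument need \<rho>w + 1 or \<rho>u + 1.
  The same holds for \<open>xi2\<close>.\<close>

definition xi1 :: "real \<Rightarrow> real \<Rightarrow> real" where
  "xi1 W U = W * (\<Sum>l\<in>UNIV. (U * \<rho>x) powr (\<alpha> $ l))"
definition xi2 :: "real \<Rightarrow> real \<Rightarrow> real" where
  "xi2 W U = W * (\<Sum>l\<in>UNIV. \<alpha> $ l * (U * \<rho>x) powr (\<alpha> $ l))"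
definition \<alpha>max :: real where "\<alpha>max = Max (range (\<lambda>l. \<bar>\<alpha> $ l\<bar>))"

lemma l1_vec_le_\<rho>x: "l1_vec (x i) \<le> \<rho>x"
  unfolding \<rho>x_def by (intro Max_ge) auto

lemma \<alpha>_le_\<alpha>max: "\<alpha> $ l \<le> \<alpha>max"
proof -
  have "\<bar>\<alpha> $ l\<bar> \<le> \<alpha>max" unfolding \<alpha>max_def by (intro Max_ge) auto
  then show ?thesis by simp
qed

lemma \<alpha>max_ge: "\<alpha>max \<ge> 1"
  using \<alpha>_ge \<alpha>_le_\<alpha>max order_trans by blast

lemma xi_nonneg: "W \<ge> 0 \<Longrightarrow> xi1 W U \<ge> 0" "W \<ge> 0 \<Longrightarrow> xi2 W U \<ge> 0"
  using \<alpha>_ge unfolding xi1_def xi2_def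
  by (auto intro!: mult_nonneg_nonneg sum_nonneg simp: order_trans[OF zero_le_one])

lemma net_diff_le:
  assumes "ratio_close a b z z'" "a \<ge> 0" "b \<ge> 0"
    "\<And>r l. fst z $ r $ l \<le> W" "\<And>r l. fst z' $ r $ l \<le> W"
    "\<And>l m. snd z $ l $ m \<le> U" "\<And>l m. snd z' $ l $ m \<le> U"
  shows "\<bar>net \<alpha> (fst z) (snd z) (x i) r - net \<alpha> (fst z') (snd z') (x i) r\<bar> \<le> xi1 W U * a + xi2 W U * b"
  unfolding xi1_def xi2_def
  using assms l1_vec_le_\<rho>x x_nonneg \<alpha>_ge by (intro abs_net_diff_le) (auto simp: ratio_close_def)

text \<open>Bounds what a small rescaling of a block costs. It holds without positivity of the
  entries, as the boundary argument requires.\<close>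

lemma Phi_diff_le:
  assumes z: "ratio_close a b z z'" "a \<ge> 0" "b \<ge> 0"
    "\<And>r l. fst z $ r $ l \<le> W" "\<And>r l. fst z' $ r $ l \<le> W"
    "\<And>l m. snd z $ l $ m \<le> U" "\<And>l m. snd z' $ l $ m \<le> U"
  shows "\<Phi> z - \<Phi> z' \<le> (2 + real CARD('k)) * (xi1 W U * a + xi2 W U * b)
    + \<epsilon> * (real CARD('k) * real CARD('h) * W * a + real CARD('h) * real CARD('d) * U * b)"
proof -
  let ?N = "\<lambda>z i. net \<alpha> (fst z) (snd z) (x i)"
  let ?\<eta> = "xi1 W U * a + xi2 W U * b"
  have "(\<Sum>i\<in>UNIV. score (y i) (?N z i) - score (y i) (?N z' i)) \<le> (\<Sum>i\<in>(UNIV::'n set). (2 + real CARD('k)) * ?\<eta>)"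
    by (intro sum_mono score_diff_le net_diff_le z)
  then have 1: "(1 / real CARD('n)) * (\<Sum>i\<in>UNIV. score (y i) (?N z i)) - (1 / real CARD('n)) * (\<Sum>i\<in>UNIV. score (y i) (?N z' i))
      \<le> (2 + real CARD('k)) * ?\<eta>"
    by (simp add: sum_subtractf field_simps)
  have w: "fst z $ r $ l - fst z' $ r $ l \<le> W * a" for r l
    using ratio_bound_abs_diff[of a "fst z $ r $ l" "fst z' $ r $ l" W] z by (auto simp: ratio_close_def abs_le_iff)
  have u: "snd z $ l $ m - snd z' $ l $ m \<le> U * b" for l m
    using ratio_bound_abs_diff[of b "snd z $ l $ m" "snd z' $ l $ m" U] z by (auto simp: ratio_close_def abs_le_iff)
  have "(\<Sum>r\<in>UNIV. \<Sum>l\<in>UNIV. fst z $ r $ l - fst z' $ r $ l) \<le> (\<Sum>r\<in>(UNIV::'k set). \<Sum>l\<in>(UNIV::'h set). W * a)"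
    by (intro sum_mono w)
  moreover have "(\<Sum>l\<in>UNIV. \<Sum>m\<in>UNIV. snd z $ l $ m - snd z' $ l $ m) \<le> (\<Sum>l\<in>(UNIV::'h set). \<Sum>m\<in>(UNIV::'d set). U * b)"
    by (intro sum_mono u)
  ultimately have "\<epsilon> * (((\<Sum>r\<in>UNIV. \<Sum>l\<in>UNIV. fst z $ r $ l) + (\<Sum>l\<in>UNIV. \<Sum>m\<in>UNIV. snd z $ l $ m))
      - ((\<Sum>r\<in>UNIV. \<Sum>l\<in>UNIV. fst z' $ r $ l) + (\<Sum>l\<in>UNIV. \<Sum>m\<in>UNIV. snd z' $ l $ m)))
      \<le> \<epsilon> * (real CARD('k) * real CARD('h) * W * a + real CARD('h) * real CARD('d) * U * b)"
    using \<epsilon> by (intro mult_left_mono) (auto simp: sum_subtractf mult_ac)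
  with 1 show ?thesis unfolding Phi_eq by (simp add: algebra_simps)
qed

text \<open>The data term is monotone by \<open>score_mono\<close>, so the objective grows by at
  least \<epsilon> times the total increase of the entries, of which a single entry is a part. At
  boundary points this replaces a lower bound on the gradient.\<close>

lemma Phi_mono:
  assumes nn: "\<And>r l. fst z $ r $ l \<ge> 0" "\<And>l m. snd z $ l $ m \<ge> 0"
    and le: "\<And>r l. fst z $ r $ l \<le> fst z' $ r $ l" "\<And>l m. snd z $ l $ m \<le> snd z' $ l $ m"
  shows "\<epsilon> * (fst z' $ r $ l - fst z $ r $ l) \<le> \<Phi> z' - \<Phi> z"
    and "\<epsilon> * (snd z' $ l $ m - snd z $ l $ m) \<le> \<Phi> z' - \<Phi> z"
proof -
  let ?N = "\<lambda>z i. net \<alpha> (fst z) (snd z) (x i)"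
  have \<alpha>0: "\<alpha> $ l \<ge> 0" for l using \<alpha>_ge[of l] by simp
  have pre: "preact (snd z) (x i) l \<le> preact (snd z') (x i) l" for i l
    unfolding preact_def using le x_nonneg by (intro sum_mono mult_right_mono) auto
  have "?N z i r \<le> ?N z' i r" for i r
    unfolding net_preact using pre preact_nonneg[OF nn(2) x_nonneg] nn le \<alpha>0
    by (intro sum_mono mult_mono powr_mono2) (auto intro: order_trans[OF nn(1) le(1)])
  then have "(\<Sum>i\<in>UNIV. score (y i) (?N z i)) \<le> (\<Sum>i\<in>UNIV. score (y i) (?N z' i))"
    by (intro sum_mono score_mono)
  then have 1: "(1 / real CARD('n)) * (\<Sum>i\<in>UNIV. score (y i) (?N z i)) \<le> (1 / real CARD('n)) * (\<Sum>i\<in>UNIV. score (y i) (?N z' i))"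
    by (simp add: divide_right_mono)
  let ?W = "\<Sum>r\<in>UNIV. \<Sum>l\<in>UNIV. fst z' $ r $ l - fst z $ r $ l"
  let ?U = "\<Sum>l\<in>UNIV. \<Sum>m\<in>UNIV. snd z' $ l $ m - snd z $ l $ m"
  have diff: "\<epsilon> * (?W + ?U) \<le> \<Phi> z' - \<Phi> z"
    using 1 unfolding Phi_eq by (simp add: sum_subtractf algebra_simps)
  have "fst z' $ r $ l - fst z $ r $ l \<le> (\<Sum>l\<in>UNIV. fst z' $ r $ l - fst z $ r $ l)"
    using le by (intro member_le_sum) auto
  also have "\<dots> \<le> ?W"
    using le by (intro member_le_sum[where f="\<lambda>r. \<Sum>l\<in>UNIV. fst z' $ r $ l - fst z $ r $ l"]) (auto intro: sum_nonneg)
  finally have W: "fst z' $ r $ l - fst z $ r $ l \<le> ?W" .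
  have "snd z' $ l $ m - snd z $ l $ m \<le> (\<Sum>m\<in>UNIV. snd z' $ l $ m - snd z $ l $ m)"
    using le by (intro member_le_sum) auto
  also have "\<dots> \<le> ?U"
    using le by (intro member_le_sum[where f="\<lambda>l. \<Sum>m\<in>UNIV. snd z' $ l $ m - snd z $ l $ m"]) (auto intro: sum_nonneg)
  finally have U: "snd z' $ l $ m - snd z $ l $ m \<le> ?U" .
  have "?W \<ge> 0" "?U \<ge> 0" using le by (auto intro!: sum_nonneg)
  then have "\<epsilon> * (fst z' $ r $ l - fst z $ r $ l) \<le> \<epsilon> * (?W + ?U)" "\<epsilon> * (snd z' $ l $ m - snd z $ l $ m) \<le> \<epsilon> * (?W + ?U)"
    using \<epsilon> W U by (auto intro!: mult_left_mono)
  then show "\<epsilon> * (fst z' $ r $ l - fst z $ r $ l) \<le> \<Phi> z' - \<Phi> z" "\<epsilon> * (snd z' $ l $ m - snd z $ l $ m) \<le> \<Phi> z' - \<Phi> z"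
    using diff by linarith+
qed

section \<open>Positivity of the gradients and the contraction estimate\<close>

lemma Phi_grad_w_pos: "(\<And>l m. snd z $ l $ m > 0) \<Longrightarrow> Phi_grad_w x y \<alpha> \<epsilon> z r l > 0"
  unfolding Phi_grad_w_def using \<epsilon>
  by (intro add_nonneg_pos mult_nonneg_nonneg sum_nonneg score_deriv_nonneg) auto

lemma Phi_grad_u_pos:
  assumes "\<And>r l. fst z $ r $ l > 0"
  shows "Phi_grad_u x y \<alpha> \<epsilon> z l m > 0"
proof -
  have "\<alpha> $ l \<ge> 0" using \<alpha>_ge[of l] by simp
  then show ?thesis
    unfolding Phi_grad_u_def using \<epsilon> assms x_nonneg
    by (intro add_nonneg_pos mult_nonneg_nonneg sum_nonneg score_deriv_nonneg) (auto intro: less_imp_le)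
qed

lemma fst_G:
  assumes "\<And>l m. snd z $ l $ m > 0"
  shows "fst (G z) $ r $ l = normalize_lp pw \<rho>w (Phi_grad_w x y \<alpha> \<epsilon> z r) l"
  by (simp add: G_map_def Let_def normalize_lp_def lp_vec_lp_norm vec_nth_vec_lambda grad_w_Phi[OF assms x_nonneg])

lemma snd_G:
  assumes "\<And>l m. snd z $ l $ m > 0"
  shows "snd (G z) $ l $ m = normalize_lp pu \<rho>u (\<lambda>(l, m). Phi_grad_u x y \<alpha> \<epsilon> z l m) (l, m)"
  by (simp add: G_map_def Let_def normalize_lp_def lp_mat_lp_norm grad_u_Phi[OF assms x_nonneg] case_prod_unfold)

lemma G_in_Spp:
  assumes "z \<in> Spp" shows "G z \<in> Spp"
proof -
  have u: "\<And>l m. snd z $ l $ m > 0" and w: "\<And>r l. fst z $ r $ l > 0"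
    using assms by (auto simp: mem_S_pplus)
  have gu: "(case i of (l, m) \<Rightarrow> Phi_grad_u x y \<alpha> \<epsilon> z l m) > 0" for i
    using Phi_grad_u_pos[OF w] by (auto split: prod.split)
  show ?thesis unfolding mem_S_pplus fst_G[OF u] snd_G[OF u] case_prod_eta
    by (intro conjI allI normalize_lp_pos lp_norm_normalize_lp pw pu \<rho>w \<rho>u Phi_grad_w_pos u gu)
qed

text \<open>The factor 2 in front comes from the normalisation: numerator and norm both change by the same ratio.\<close>
lemma G_ratio_close:
  assumes z: "z \<in> Spp" and z': "z' \<in> Spp" and cl: "ratio_close a b z z'" and ab: "a \<ge> 0" "b \<ge> 0"
  shows "ratio_close (2 * ((conj_exp pw - 1) * (2 * (xi1 \<rho>w \<rho>u * a + xi2 \<rho>w \<rho>u * b) + \<alpha>max * b)))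
      (2 * ((conj_exp pu - 1) * (2 * (xi1 \<rho>w \<rho>u * a + xi2 \<rho>w \<rho>u * b) + (a + (\<alpha>max - 1) * b)))) (G z) (G z')"
proof -
  let ?\<eta> = "xi1 \<rho>w \<rho>u * a + xi2 \<rho>w \<rho>u * b"
  let ?N = "\<lambda>z i. net \<alpha> (fst z) (snd z) (x i)"
  note pos = z[unfolded mem_S_pplus] z'[unfolded mem_S_pplus]
  have u: "\<And>l m. snd z $ l $ m > 0" "\<And>l m. snd z' $ l $ m > 0" and w: "\<And>r l. fst z $ r $ l > 0" "\<And>r l. fst z' $ r $ l > 0"
    using pos by auto
  have p0: "pw > 0" "pu > 0" using pw pu by auto
  have zSp: "z \<in> Sp" "z' \<in> Sp" by (rule subsetD[OF S_pplus_subset z], rule subsetD[OF S_pplus_subset z'])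
  have \<eta>: "?\<eta> \<ge> 0" using xi_nonneg[of \<rho>w \<rho>u] \<rho>w ab by auto
  have c: "ratio_bound (2 * ?\<eta>) (score_deriv (y i) (?N z i) r) (score_deriv (y i) (?N z' i) r)" for i r
    by (intro ratio_bound_score_deriv net_diff_le cl ab S_plus_le[OF zSp(1) p0] S_plus_le[OF zSp(2) p0])
  have pre: "ratio_bound b (preact (snd z) (x i) l) (preact (snd z') (x i) l)" for i l
    using cl x_nonneg by (intro ratio_bound_preact) (auto simp: ratio_close_def)
  \<comment> \<open>Exponents add along the product: 2\<eta> for the softmax factor and at most
    \<alpha>max b for the power of the preactivation. The summand \<epsilon> is constant and does
    not worsen the bound.\<close>
  have gw: "ratio_bound (2 * ?\<eta> + \<alpha>max * b) (Phi_grad_w x y \<alpha> \<epsilon> z r l) (Phi_grad_w x y \<alpha> \<epsilon> z' r l)" for r l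
  proof -
    have "\<alpha> $ l * b \<le> \<alpha>max * b" "0 \<le> \<alpha> $ l"
      using \<alpha>_le_\<alpha>max \<alpha>_ge[of l] ab by (auto intro: mult_right_mono)
    then show ?thesis unfolding Phi_grad_w_def using \<epsilon> \<eta> ab \<alpha>max_ge
      by (intro ratio_bound_add ratio_bound_const_mult ratio_bound_sum ratio_bound_mult c ratio_bound_mono[OF ratio_bound_powr[OF pre]] ratio_bound_refl) auto
  qed
  \<comment> \<open>Here the weight w contributes a and differentiation lowers the power to
    \<alpha>_l - 1; this is the origin of the +1 and -1 in the last row of the matrix A.\<close>
  have gu: "ratio_bound (2 * ?\<eta> + (a + (\<alpha>max - 1) * b)) (Phi_grad_u x y \<alpha> \<epsilon> z l m) (Phi_grad_u x y \<alpha> \<epsilon> z' l m)" for l m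
  proof -
    have *: "(\<alpha> $ l - 1) * b \<le> (\<alpha>max - 1) * b" "0 \<le> \<alpha> $ l - 1"
      using \<alpha>_le_\<alpha>max[of l] \<alpha>_ge[of l] ab by (auto intro: mult_right_mono)
    have "ratio_bound (0 + (\<alpha>max - 1) * b + 0) (\<alpha> $ l * preact (snd z) (x i) l powr (\<alpha> $ l - 1) * x i $ m)
        (\<alpha> $ l * preact (snd z') (x i) l powr (\<alpha> $ l - 1) * x i $ m)" for i
      using * x_nonneg by (intro ratio_bound_mult ratio_bound_mono[OF ratio_bound_powr[OF pre]] ratio_bound_refl) auto
    then have "ratio_bound ((\<alpha>max - 1) * b) (\<alpha> $ l * preact (snd z) (x i) l powr (\<alpha> $ l - 1) * x i $ m)
        (\<alpha> $ l * preact (snd z') (x i) l powr (\<alpha> $ l - 1) * x i $ m)" for i by simp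
    then show ?thesis unfolding Phi_grad_u_def using \<epsilon> \<eta> ab \<alpha>max_ge cl
      by (intro ratio_bound_add ratio_bound_const_mult ratio_bound_sum ratio_bound_mult c ratio_bound_refl) (auto simp: ratio_close_def)
  qed
  have gu': "ratio_bound (2 * ?\<eta> + (a + (\<alpha>max - 1) * b)) (case i of (l, m) \<Rightarrow> Phi_grad_u x y \<alpha> \<epsilon> z l m)
      (case i of (l, m) \<Rightarrow> Phi_grad_u x y \<alpha> \<epsilon> z' l m)" for i
    using gu by (auto split: prod.split)
  have gu_pos: "(case i of (l, m) \<Rightarrow> Phi_grad_u x y \<alpha> \<epsilon> z l m) > 0" "(case i of (l, m) \<Rightarrow> Phi_grad_u x y \<alpha> \<epsilon> z' l m) > 0" for i
    using Phi_grad_u_pos[OF w(1)] Phi_grad_u_pos[OF w(2)] by (auto split: prod.split)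
  show ?thesis unfolding ratio_close_def fst_G[OF u(1)] fst_G[OF u(2)] snd_G[OF u(1)] snd_G[OF u(2)]
    by (intro conjI allI ratio_bound_normalize_lp pw pu \<rho>w \<rho>u Phi_grad_w_pos u gu_pos gw gu')
qed

end

lemma sup_norm_pair_le:
  assumes "\<And>r l. \<bar>fst z $ r $ l\<bar> \<le> c" "\<And>l m. \<bar>snd z $ l $ m\<bar> \<le> c"
  shows "sup_norm_pair z \<le> c"
proof -
  have *: "Max {\<bar>M $ i $ j\<bar> | i j. True} \<le> c" if "\<And>i j. \<bar>M $ i $ j\<bar> \<le> c"
    for M :: "real^'j::finite^'i::finite"
  proof -
    have "{\<bar>M $ i $ j\<bar> | i j. True} = range (\<lambda>(i, j). \<bar>M $ i $ j\<bar>)" by auto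
    then show ?thesis using that by auto
  qed
  show ?thesis using *[of "fst z"] *[of "snd z"] assms by (simp add: sup_norm_pair_def case_prod_unfold)
qed

lemma ratio_close_mono: "ratio_close a b z z' \<Longrightarrow> a \<le> a' \<Longrightarrow> b \<le> b' \<Longrightarrow> ratio_close a' b' z z'"
  unfolding ratio_close_def by (blast intro: ratio_bound_mono)

lemma ratio_close_ex:
  fixes z z' :: "(real^'h::finite^'k::finite) \<times> (real^'d::finite^'h)"
  assumes "z \<in> S_pplus pw pu \<rho>w \<rho>u" "z' \<in> S_pplus pw pu \<rho>w \<rho>u"
  shows "\<exists>\<kappa>\<ge>0. ratio_close \<kappa> \<kappa> z z'"
proof -
  obtain \<kappa>1 where 1: "\<kappa>1 \<ge> 0" "\<forall>i\<in>UNIV. ratio_bound \<kappa>1 (fst z $ fst i $ snd i) (fst z' $ fst i $ snd i)"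
    using ratio_bound_ex[of UNIV "\<lambda>i. fst z $ fst i $ snd i" "\<lambda>i. fst z' $ fst i $ snd i"] assms
    by (auto simp: mem_S_pplus)
  obtain \<kappa>2 where 2: "\<kappa>2 \<ge> 0" "\<forall>i\<in>UNIV. ratio_bound \<kappa>2 (snd z $ fst i $ snd i) (snd z' $ fst i $ snd i)"
    using ratio_bound_ex[of UNIV "\<lambda>i. snd z $ fst i $ snd i" "\<lambda>i. snd z' $ fst i $ snd i"] assms
    by (auto simp: mem_S_pplus)
  show ?thesis
  proof (intro exI conjI)
    show "ratio_close (\<kappa>1 + \<kappa>2) (\<kappa>1 + \<kappa>2) z z'"
      unfolding ratio_close_def using 1 2 by (auto intro: ratio_bound_mono[of \<kappa>1] ratio_bound_mono[of \<kappa>2])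
  qed (use 1 2 in auto)
qed

section \<open>Maximizers are positive fixed points\<close>

context network_problem
begin

text \<open>Raising a vanishing coordinate to t gains at least \<epsilon>t; rescaling the block back to the sphere
  costs only O(t^p), because the block is scaled by (1 + (t/\<rho>)^p)^(-1/p).\<close>
lemma maximizer_fst_pos:
  assumes z: "z \<in> Sp" and max: "\<And>z'. z' \<in> Sp \<Longrightarrow> \<Phi> z' \<le> \<Phi> z"
  shows "fst z $ r $ l > 0"
proof (rule ccontr)
  assume "\<not> fst z $ r $ l > 0"
  moreover have "fst z $ r $ l \<ge> 0" using z by (simp add: mem_S_plus)
  ultimately have zero: "fst z $ r $ l = 0" by simp
  have p0: "pw > 0" "pu > 0" using pw pu by auto
  note le = S_plus_le[OF z p0]
  \<comment> \<open>The coefficient of \<kappa> in \<open>Phi_diff_le\<close> when only w changes; t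
    \<le> 1 keeps the entries of w below \<rho>w + 1.\<close>
  define C where "C = (2 + real CARD('k)) * xi1 (\<rho>w + 1) \<rho>u + \<epsilon> * (real CARD('k) * real CARD('h) * (\<rho>w + 1))"
  have C: "C \<ge> 0" unfolding C_def using \<epsilon> \<rho>w xi_nonneg[of "\<rho>w + 1" \<rho>u] by simp
  show False
  proof (rule sublinear_contradiction[OF pw \<rho>w \<epsilon> C])
    fix t :: real assume t: "0 < t" "t \<le> 1"
    let ?f = "(\<lambda>l. fst z $ r $ l)(l := t)"
    define \<kappa> where "\<kappa> = ln (1 + (t / \<rho>w) powr pw) / pw"
    have \<kappa>: "\<kappa> \<ge> 0" unfolding \<kappa>_def using pw by (intro divide_nonneg_nonneg ln_ge_zero) auto
    \<comment> \<open>\<open>z1\<close> has the raised coordinate and has left the sphere;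
      \<open>z2\<close> is its feasible rescaling. Only row r differs, so the two are close with
      radius 0 in u.\<close>
    define z1 where "z1 = ((\<chi> r' l'. if r' = r then ?f l' else fst z $ r' $ l'), snd z)"
    define z2 where "z2 = ((\<chi> r' l'. if r' = r then exp (- \<kappa>) * ?f l' else fst z $ r' $ l'), snd z)"
    have w1: "fst z1 $ r' $ l' = (if r' = r then ?f l' else fst z $ r' $ l')" for r' l' by (simp add: z1_def)
    have w2: "fst z2 $ r' $ l' = (if r' = r then exp (- \<kappa>) * ?f l' else fst z $ r' $ l')" for r' l' by (simp add: z2_def)
    have u: "snd z1 = snd z" "snd z2 = snd z" by (auto simp: z1_def z2_def)
    have nn: "fst z $ r' $ l' \<ge> 0" "snd z $ l' $ m \<ge> 0" for r' l' m using z by (auto simp: mem_S_plus)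
    have f: "0 \<le> ?f l'" "?f l' \<le> \<rho>w + 1" for l'
      using nn t \<rho>w le(1)[of r l'] by auto
    have "\<epsilon> * (fst z1 $ r $ l - fst z $ r $ l) \<le> \<Phi> z1 - \<Phi> z"
      by (rule Phi_mono) (use nn zero t in \<open>auto simp: w1 u\<close>)
    then have gain: "\<epsilon> * t \<le> \<Phi> z1 - \<Phi> z" by (simp add: w1 zero)
    have "ratio_close \<kappa> 0 z1 z2"
      unfolding ratio_close_def w1 w2 u using \<kappa> f nn by (auto simp del: fun_upd_apply intro!: ratio_bound_exp_scale ratio_bound_refl)
    moreover have "exp (- \<kappa>) * ?f l' \<le> \<rho>w + 1" for l'
    proof -
      have "exp (- \<kappa>) * ?f l' \<le> 1 * (\<rho>w + 1)"
        using f[of l'] \<kappa> by (intro mult_mono) auto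
      then show ?thesis by simp
    qed
    moreover have "fst z $ r' $ l' \<le> \<rho>w + 1" for r' l' using le(1)[of r' l'] by simp
    ultimately have "\<Phi> z1 - \<Phi> z2 \<le> (2 + real CARD('k)) * (xi1 (\<rho>w + 1) \<rho>u * \<kappa> + xi2 (\<rho>w + 1) \<rho>u * 0)
        + \<epsilon> * (real CARD('k) * real CARD('h) * (\<rho>w + 1) * \<kappa> + real CARD('h) * real CARD('d) * \<rho>u * 0)"
      using f \<kappa> le(2) by (intro Phi_diff_le) (auto simp: w1 w2 u simp del: fun_upd_apply)
    moreover have "\<Phi> z2 \<le> \<Phi> z"
    proof (rule max)
      have "lp_norm pw (\<lambda>l'. exp (- \<kappa>) * ?f l') = \<rho>w"
        using z t zero by (intro lp_norm_bump[OF pw \<rho>w _ _ _ \<kappa>_def]) (auto simp: mem_S_plus)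
      then have "lp_norm pw (\<lambda>l'. fst z2 $ r' $ l') = \<rho>w" for r'
        using z by (cases "r' = r") (simp_all add: w2 mem_S_plus del: fun_upd_apply)
      moreover have "fst z2 $ r' $ l' \<ge> 0" for r' l'
        unfolding w2 using f(1)[of l'] nn by (simp del: fun_upd_apply)
      ultimately show "z2 \<in> Sp" using z by (simp add: mem_S_plus u)
    qed
    \<comment> \<open>The chain is \<epsilon> t \<le> \<Phi> z1 - \<Phi> z \<le> \<Phi> z1 - \<Phi>
      z2 \<le> C \<kappa>, the middle step by maximality of z.\<close>
    ultimately show "\<epsilon> * t \<le> C * (ln (1 + (t / \<rho>w) powr pw) / pw)"
      using gain unfolding C_def \<kappa>_def[symmetric] by (simp add: algebra_simps)
  qed
qed

lemma maximizer_snd_pos: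
  assumes z: "z \<in> Sp" and max: "\<And>z'. z' \<in> Sp \<Longrightarrow> \<Phi> z' \<le> \<Phi> z"
  shows "snd z $ l $ m > 0"
proof (rule ccontr)
  assume "\<not> snd z $ l $ m > 0"
  moreover have "snd z $ l $ m \<ge> 0" using z by (simp add: mem_S_plus)
  ultimately have zero: "snd z $ l $ m = 0" by simp
  have p0: "pw > 0" "pu > 0" using pw pu by auto
  note le = S_plus_le[OF z p0]
  \<comment> \<open>Now only u changes, so the coefficient of b in \<open>Phi_diff_le\<close>
    counts, with entries of u bounded by \<rho>u + 1.\<close>
  define C where "C = (2 + real CARD('k)) * xi2 \<rho>w (\<rho>u + 1) + \<epsilon> * (real CARD('h) * real CARD('d) * (\<rho>u + 1))"
  have C: "C \<ge> 0" unfolding C_def using \<epsilon> \<rho>w \<rho>u xi_nonneg[of \<rho>w "\<rho>u + 1"] by simp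
  show False
  proof (rule sublinear_contradiction[OF pu \<rho>u \<epsilon> C])
    fix t :: real assume t: "0 < t" "t \<le> 1"
    let ?f = "(\<lambda>(l, m). snd z $ l $ m)((l, m) := t)"
    define \<kappa> where "\<kappa> = ln (1 + (t / \<rho>u) powr pu) / pu"
    have \<kappa>: "\<kappa> \<ge> 0" unfolding \<kappa>_def using pu by (intro divide_nonneg_nonneg ln_ge_zero) auto
    define z1 where "z1 = (fst z, (\<chi> l' m'. ?f (l', m')))"
    define z2 where "z2 = (fst z, (\<chi> l' m'. exp (- \<kappa>) * ?f (l', m')))"
    have u1: "snd z1 $ l' $ m' = ?f (l', m')" for l' m' by (simp add: z1_def)
    have u2: "snd z2 $ l' $ m' = exp (- \<kappa>) * ?f (l', m')" for l' m' by (simp add: z2_def)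
    have w: "fst z1 = fst z" "fst z2 = fst z" by (auto simp: z1_def z2_def)
    have nn: "fst z $ r' $ l' \<ge> 0" "snd z $ l' $ m \<ge> 0" for r' l' m using z by (auto simp: mem_S_plus)
    have f: "0 \<le> ?f (l', m')" "?f (l', m') \<le> \<rho>u + 1" for l' m'
      using nn t \<rho>u le(2)[of l' m'] by auto
    have "\<epsilon> * (snd z1 $ l $ m - snd z $ l $ m) \<le> \<Phi> z1 - \<Phi> z"
      by (rule Phi_mono) (use nn zero t in \<open>auto simp: u1 w\<close>)
    then have gain: "\<epsilon> * t \<le> \<Phi> z1 - \<Phi> z" by (simp add: u1 zero)
    have "ratio_close 0 \<kappa> z1 z2"
      unfolding ratio_close_def u1 u2 w using \<kappa> f nn by (auto simp del: fun_upd_apply intro!: ratio_bound_exp_scale ratio_bound_refl)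
    moreover have "exp (- \<kappa>) * ?f (l', m') \<le> \<rho>u + 1" for l' m'
    proof -
      have "exp (- \<kappa>) * ?f (l', m') \<le> 1 * (\<rho>u + 1)"
        using f[of l' m'] \<kappa> by (intro mult_mono) auto
      then show ?thesis by simp
    qed
    ultimately have "\<Phi> z1 - \<Phi> z2 \<le> (2 + real CARD('k)) * (xi1 \<rho>w (\<rho>u + 1) * 0 + xi2 \<rho>w (\<rho>u + 1) * \<kappa>)
        + \<epsilon> * (real CARD('k) * real CARD('h) * \<rho>w * 0 + real CARD('h) * real CARD('d) * (\<rho>u + 1) * \<kappa>)"
      using f \<kappa> le(1) by (intro Phi_diff_le) (auto simp: u1 u2 w simp del: fun_upd_apply)
    moreover have "\<Phi> z2 \<le> \<Phi> z"
    proof (rule max)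
      have "lp_norm pu (\<lambda>i. exp (- \<kappa>) * ?f i) = \<rho>u"
        using z t zero by (intro lp_norm_bump[OF pu \<rho>u _ _ _ \<kappa>_def]) (auto simp: mem_S_plus)
      moreover have "(\<lambda>(l', m'). snd z2 $ l' $ m') = (\<lambda>i. exp (- \<kappa>) * ?f i)"
        unfolding u2 by auto
      moreover have "snd z2 $ l' $ m' \<ge> 0" for l' m'
        unfolding u2 using f(1)[of l' m'] by (simp del: fun_upd_apply)
      ultimately show "z2 \<in> Sp" using z by (simp add: mem_S_plus w)
    qed
    ultimately show "\<epsilon> * t \<le> C * (ln (1 + (t / \<rho>u) powr pu) / pu)"
      using gain unfolding C_def \<kappa>_def[symmetric] by (simp add: algebra_simps)
  qed
qed

lemma maximizer_in_Spp:
  assumes "z \<in> Sp" "\<And>z'. z' \<in> Sp \<Longrightarrow> \<Phi> z' \<le> \<Phi> z"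
  shows "z \<in> Spp"
  using maximizer_fst_pos[OF assms] maximizer_snd_pos[OF assms] assms(1)
  by (auto simp: mem_S_plus mem_S_pplus)

text \<open>Trading two coordinates of one block along its sphere stays feasible, so
  \<open>lagrange_two_coordinates\<close> makes the partial gradient of each block proportional to
  the (p-1)-th power of the block. By \<open>normalize_lp_fixed\<close> such a block is reproduced
  by G.\<close>

lemma maximizer_fixed_point:
  assumes z: "z \<in> Spp" and max: "\<And>z'. z' \<in> Sp \<Longrightarrow> \<Phi> z' \<le> \<Phi> z"
  shows "G z = z"
proof -
  have w: "\<And>r l. fst z $ r $ l > 0" and u: "\<And>l m. snd z $ l $ m > 0"
    and nw: "\<And>r. lp_norm pw (\<lambda>l. fst z $ r $ l) = \<rho>w" and nu: "lp_norm pu (\<lambda>(l, m). snd z $ l $ m) = \<rho>u"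
    using z by (auto simp: mem_S_pplus)
  have p0: "pw > 0" "pu > 0" using pw pu by auto
  let ?D = "frechet_derivative \<Phi> (at z)"
  have D: "(\<Phi> has_derivative ?D) (at z)"
    by (rule frechet_derivative_works[THEN iffD1, OF differentiableI[OF has_derivative_Phi[OF u x_nonneg]]])
  have Dw: "?D (axis r (axis l 1), 0) = Phi_grad_w x y \<alpha> \<epsilon> z r l" for r l
    using grad_w_Phi[OF u x_nonneg] by (simp add: grad_w_def)
  have Du: "?D (0, axis l (axis m 1)) = Phi_grad_u x y \<alpha> \<epsilon> z l m" for l m
    using grad_u_Phi[OF u x_nonneg] by (simp add: grad_u_def)
  have pw_eq: "Phi_grad_w x y \<alpha> \<epsilon> z r l * fst z $ r $ k powr (pw - 1)
      = Phi_grad_w x y \<alpha> \<epsilon> z r k * fst z $ r $ l powr (pw - 1)" for r k l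
  proof (cases "k = l")
    case False
    show ?thesis unfolding Dw[symmetric]
    proof (rule lagrange_two_coordinates[OF D pw w w])
      fix s t :: real
      assume st: "s > 0" "t > 0" "s powr pw + t powr pw = fst z $ r $ k powr pw + fst z $ r $ l powr pw"
      let ?z = "z + (s - fst z $ r $ k) *\<^sub>R (axis r (axis k 1), 0) + (t - fst z $ r $ l) *\<^sub>R (axis r (axis l 1), 0)"
      let ?f = "(\<lambda>l. fst z $ r $ l)(k := s, l := t)"
      have zw: "fst ?z $ r' $ l' = (if r' = r then ?f l' else fst z $ r' $ l')" for r' l'
        using False by (auto simp: axis_def)
      have zu: "snd ?z = snd z" by simp
      have "lp_norm pw ?f = \<rho>w"
        using False st w p0 by (subst lp_norm_fun_upd2) (auto simp: nw less_imp_le)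
      then have "lp_norm pw (\<lambda>l'. fst ?z $ r' $ l') = \<rho>w" for r'
        unfolding zw using nw by (cases "r' = r") (simp_all del: fun_upd_apply)
      moreover have "fst ?z $ r' $ l' \<ge> 0" for r' l'
        unfolding zw using st w by (auto intro: less_imp_le)
      moreover have "\<forall>l m. snd z $ l $ m \<ge> 0" using u by (auto intro: less_imp_le)
      ultimately have "?z \<in> Sp" unfolding mem_S_plus zu using nu by blast
      then show "\<Phi> ?z \<le> \<Phi> z" by (rule max)
    qed
  qed simp
  have pu_eq: "Phi_grad_u x y \<alpha> \<epsilon> z l2 m2 * snd z $ l1 $ m1 powr (pu - 1)
      = Phi_grad_u x y \<alpha> \<epsilon> z l1 m1 * snd z $ l2 $ m2 powr (pu - 1)" for l1 m1 l2 m2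
  \<comment> \<open>The whole matrix u carries a single norm constraint, so entries of different
    rows are traded as well.\<close>
  proof (cases "(l1, m1) = (l2, m2)")
    case False
    show ?thesis unfolding Du[symmetric]
    proof (rule lagrange_two_coordinates[OF D pu u u])
      fix s t :: real
      assume st: "s > 0" "t > 0" "s powr pu + t powr pu = snd z $ l1 $ m1 powr pu + snd z $ l2 $ m2 powr pu"
      let ?z = "z + (s - snd z $ l1 $ m1) *\<^sub>R (0, axis l1 (axis m1 1)) + (t - snd z $ l2 $ m2) *\<^sub>R (0, axis l2 (axis m2 1))"
      let ?f = "(\<lambda>(l, m). snd z $ l $ m)((l1, m1) := s, (l2, m2) := t)"
      have zu: "snd ?z $ l' $ m' = ?f (l', m')" for l' m'
        using False by (auto simp: axis_def)
      have zw: "fst ?z = fst z" by simp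
      have "lp_norm pu ?f = \<rho>u"
        using False st u p0 by (subst lp_norm_fun_upd2) (auto simp: nu less_imp_le)
      then have "lp_norm pu (\<lambda>(l', m'). snd ?z $ l' $ m') = \<rho>u"
        unfolding zu case_prod_eta .
      moreover have "snd ?z $ l' $ m' \<ge> 0" for l' m'
        unfolding zu using st u by (auto intro: less_imp_le)
      moreover have "\<forall>r l. fst z $ r $ l \<ge> 0" using w by (auto intro: less_imp_le)
      ultimately have "?z \<in> Sp" unfolding mem_S_plus zw using nw by blast
      then show "\<Phi> ?z \<le> \<Phi> z" by (rule max)
    qed
  qed simp
  have "fst (G z) $ r $ l = fst z $ r $ l" for r l
    unfolding fst_G[OF u] by (intro normalize_lp_fixed pw \<rho>w Phi_grad_w_pos u w nw pw_eq)
  moreover have "snd (G z) $ l $ m = snd z $ l $ m" for l m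
  proof -
    have "normalize_lp pu \<rho>u (\<lambda>(l, m). Phi_grad_u x y \<alpha> \<epsilon> z l m) (l, m) = (\<lambda>(l, m). snd z $ l $ m) (l, m)"
      using Phi_grad_u_pos[OF w] u pu_eq by (intro normalize_lp_fixed pu \<rho>u nu) (auto split: prod.split)
    then show ?thesis unfolding snd_G[OF u] by simp
  qed
  ultimately show ?thesis by (simp add: prod_eq_iff Finite_Cartesian_Product.vec_eq_iff)
qed

section \<open>Convergence\<close>

lemma funpow_G_in_Spp: "z \<in> Spp \<Longrightarrow> (G ^^ k) z \<in> Spp"
  by (induction k) (auto intro: G_in_Spp)

text \<open>The two inequalities say that the bound of \<open>G_ratio_close\<close>, which is linear
  in the radii, takes (s, t) below \<mu> (s, t). Measured in multiples \<delta> of these weights,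
  each iteration costs a factor \<mu>.\<close>

lemma funpow_G_ratio_close:
  assumes pos: "s > 0" "t > 0" "\<mu> > 0" "\<delta> \<ge> 0"
    and s: "2 * ((conj_exp pw - 1) * (2 * (xi1 \<rho>w \<rho>u * s + xi2 \<rho>w \<rho>u * t) + \<alpha>max * t)) \<le> \<mu> * s"
    and t: "2 * ((conj_exp pu - 1) * (2 * (xi1 \<rho>w \<rho>u * s + xi2 \<rho>w \<rho>u * t) + (s + (\<alpha>max - 1) * t))) \<le> \<mu> * t"
    and z: "z \<in> Spp" "z' \<in> Spp" and cl: "ratio_close (s * \<delta>) (t * \<delta>) z z'"
  shows "ratio_close (s * (\<mu> ^ k * \<delta>)) (t * (\<mu> ^ k * \<delta>)) ((G ^^ k) z) ((G ^^ k) z')"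
proof (induction k)
  case 0
  then show ?case using cl by simp
next
  case (Suc k)
  let ?d = "\<mu> ^ k * \<delta>"
  have d: "?d \<ge> 0" using pos by simp
  have "2 * ((conj_exp pw - 1) * (2 * (xi1 \<rho>w \<rho>u * (s * ?d) + xi2 \<rho>w \<rho>u * (t * ?d)) + \<alpha>max * (t * ?d))) \<le> s * (\<mu> ^ Suc k * \<delta>)"
    using mult_right_mono[OF s d] by (simp add: algebra_simps)
  moreover have "2 * ((conj_exp pu - 1) * (2 * (xi1 \<rho>w \<rho>u * (s * ?d) + xi2 \<rho>w \<rho>u * (t * ?d)) + (s * ?d + (\<alpha>max - 1) * (t * ?d)))) \<le> t * (\<mu> ^ Suc k * \<delta>)"
    using mult_right_mono[OF t d] by (simp add: algebra_simps)
  ultimately show ?case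
    using ratio_close_mono[OF G_ratio_close[OF funpow_G_in_Spp[OF z(1)] funpow_G_in_Spp[OF z(2)] Suc]] pos d by simp
qed

text \<open>Two positive points always have finite ratio distance, which starts the iteration.
  Entries bounded by \<rho>w and \<rho>u then turn ratios into absolute errors.\<close>

lemma funpow_G_rate:
  assumes pos: "s > 0" "t > 0" "\<mu> > 0"
    and s: "2 * ((conj_exp pw - 1) * (2 * (xi1 \<rho>w \<rho>u * s + xi2 \<rho>w \<rho>u * t) + \<alpha>max * t)) \<le> \<mu> * s"
    and t: "2 * ((conj_exp pu - 1) * (2 * (xi1 \<rho>w \<rho>u * s + xi2 \<rho>w \<rho>u * t) + (s + (\<alpha>max - 1) * t))) \<le> \<mu> * t"
    and z: "z \<in> Spp" "zs \<in> Spp" and fixp: "G zs = zs"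
  obtains R where "R > 0"
    "\<And>k r l. \<bar>fst ((G ^^ k) z) $ r $ l - fst zs $ r $ l\<bar> \<le> R * \<mu> ^ k"
    "\<And>k l m. \<bar>snd ((G ^^ k) z) $ l $ m - snd zs $ l $ m\<bar> \<le> R * \<mu> ^ k"
proof -
  obtain \<kappa> where \<kappa>: "\<kappa> \<ge> 0" "ratio_close \<kappa> \<kappa> z zs" using ratio_close_ex[OF z] by blast
  \<comment> \<open>Chosen so that both s \<delta> and t \<delta> are at least \<kappa>.\<close>
  define \<delta> where "\<delta> = \<kappa> / s + \<kappa> / t"
  have \<delta>: "\<delta> \<ge> 0" unfolding \<delta>_def using pos \<kappa> by simp
  have "\<kappa> \<le> s * \<delta>" "\<kappa> \<le> t * \<delta>" unfolding \<delta>_def using pos \<kappa> by (auto simp: field_simps)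
  then have "ratio_close (s * \<delta>) (t * \<delta>) z zs" by (rule ratio_close_mono[OF \<kappa>(2)])
  then have cl: "ratio_close (s * (\<mu> ^ k * \<delta>)) (t * (\<mu> ^ k * \<delta>)) ((G ^^ k) z) ((G ^^ k) zs)" for k
    by (intro funpow_G_ratio_close assms \<delta>)
  have fixk: "(G ^^ k) zs = zs" for k by (induction k) (auto simp: fixp)
  have p0: "pw > 0" "pu > 0" using pw pu by auto
  have Sp: "(G ^^ k) z \<in> Sp" "zs \<in> Sp" for k
    using funpow_G_in_Spp[OF z(1)] z(2) S_pplus_subset by blast+
  have d: "\<mu> ^ k * \<delta> \<ge> 0" for k using pos \<delta> by simp
  \<comment> \<open>The summand 1 keeps R positive when \<delta> = 0.\<close>
  let ?R = "\<rho>w * (s * \<delta>) + \<rho>u * (t * \<delta>) + 1"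
  have nn: "\<rho>w * (s * \<delta>) \<ge> 0" "\<rho>u * (t * \<delta>) \<ge> 0" using \<rho>w \<rho>u pos \<delta> by auto
  show thesis
  proof (rule that[of ?R])
    show "?R > 0" using nn by linarith
  next
    fix k r l
    have "\<bar>fst ((G ^^ k) z) $ r $ l - fst zs $ r $ l\<bar> \<le> \<rho>w * (s * (\<mu> ^ k * \<delta>))"
      using cl[of k] d[of k] pos S_plus_le(1)[OF Sp(1) p0] S_plus_le(1)[OF Sp(2) p0]
      by (intro ratio_bound_abs_diff) (auto simp: ratio_close_def fixk)
    also have "\<dots> = (\<rho>w * (s * \<delta>)) * \<mu> ^ k" by (simp add: mult_ac)
    also have "\<dots> \<le> ?R * \<mu> ^ k" using nn pos by (intro mult_right_mono) auto
    finally show "\<bar>fst ((G ^^ k) z) $ r $ l - fst zs $ r $ l\<bar> \<le> ?R * \<mu> ^ k" .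
  next
    fix k l m
    have "\<bar>snd ((G ^^ k) z) $ l $ m - snd zs $ l $ m\<bar> \<le> \<rho>u * (t * (\<mu> ^ k * \<delta>))"
      using cl[of k] d[of k] pos S_plus_le(2)[OF Sp(1) p0] S_plus_le(2)[OF Sp(2) p0]
      by (intro ratio_bound_abs_diff) (auto simp: ratio_close_def fixk)
    also have "\<dots> = (\<rho>u * (t * \<delta>)) * \<mu> ^ k" by (simp add: mult_ac)
    also have "\<dots> \<le> ?R * \<mu> ^ k" using nn pos by (intro mult_right_mono) auto
    finally show "\<bar>snd ((G ^^ k) z) $ l $ m - snd zs $ l $ m\<bar> \<le> ?R * \<mu> ^ k" .
  qed
qed

lemma funpow_G_tendsto:
  assumes "\<And>k r l. \<bar>fst ((G ^^ k) z) $ r $ l - fst zs $ r $ l\<bar> \<le> R * \<mu> ^ k"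
    "\<And>k l m. \<bar>snd ((G ^^ k) z) $ l $ m - snd zs $ l $ m\<bar> \<le> R * \<mu> ^ k"
    and \<mu>: "0 < \<mu>" "\<mu> < 1"
  shows "(\<lambda>k. (G ^^ k) z) \<longlonglongrightarrow> zs"
proof -
  have "(\<lambda>k. R * \<mu> ^ k) \<longlonglongrightarrow> R * 0" using \<mu> by (intro tendsto_intros LIMSEQ_realpow_zero) auto
  then have lim: "(\<lambda>k. R * \<mu> ^ k) \<longlonglongrightarrow> 0" by simp
  have *: "f \<longlonglongrightarrow> c" if "\<And>k. \<bar>f k - c\<bar> \<le> R * \<mu> ^ k" for f and c :: real
  proof (rule LIM_zero_cancel, rule Lim_null_comparison[OF always_eventually lim])
    show "\<forall>k. norm (f k - c) \<le> R * \<mu> ^ k" using that by simp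
  qed
  have "(\<lambda>k. (fst ((G ^^ k) z), snd ((G ^^ k) z))) \<longlonglongrightarrow> (fst zs, snd zs)"
    by (intro tendsto_Pair vec_tendstoI * assms)
  then show ?thesis by simp
qed

end

section \<open>Combining the Perron weights, the maximizer and the contraction\<close>

theorem theorem1:
  fixes x :: "'n::finite \<Rightarrow> real^'d::finite"
    and y :: "'n \<Rightarrow> 'k::finite"
    and \<alpha> :: "real^'h::finite"
    and pw pu \<rho>w \<rho>u \<epsilon> :: real
  assumes x_nonneg: "\<forall>i m. x i $ m \<ge> 0"
    and pw: "1 < pw" and pu: "1 < pu"
    and \<rho>w: "\<rho>w > 0" and \<rho>u: "\<rho>u > 0"
    and \<epsilon>: "\<epsilon> > 0"
    and \<alpha>_ge: "\<forall>l. \<alpha> $ l \<ge> 1"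
    and \<rho>x_def: "\<rho>x = Max (range (\<lambda>i. l1_vec (x i)))"
    and \<xi>1_def: "\<xi>1 = \<rho>w * (\<Sum>l\<in>UNIV. (\<rho>u * \<rho>x) powr (\<alpha> $ l))"
    and \<xi>2_def: "\<xi>2 = \<rho>w * (\<Sum>l\<in>UNIV. \<alpha> $ l * (\<rho>u * \<rho>x) powr (\<alpha> $ l))"
    and A_def: "A = A_mat CARD('k) pw pu \<xi>1 \<xi>2 (Max (range (\<lambda>l. \<bar>\<alpha> $ l\<bar>)))"
    and \<Phi>_def: "\<Phi> = Phi x y \<alpha> \<epsilon>"
    and G_def: "G = G_map pw pu \<rho>w \<rho>u \<Phi>"
    and spec: "spectral_radius (map_mat complex_of_real A) < 1"
  shows "\<exists>zs. zs \<in> S_plus pw pu \<rho>w \<rho>u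
           \<and> (\<forall>z\<in>S_plus pw pu \<rho>w \<rho>u. \<Phi> z \<le> \<Phi> zs)
           \<and> (\<forall>z\<in>S_plus pw pu \<rho>w \<rho>u. (\<forall>z'\<in>S_plus pw pu \<rho>w \<rho>u. \<Phi> z' \<le> \<Phi> z) \<longrightarrow> z = zs)
           \<and> zs \<in> S_pplus pw pu \<rho>w \<rho>u
           \<and> (\<forall>z0\<in>S_pplus pw pu \<rho>w \<rho>u.
                (\<lambda>k. (G ^^ k) z0) \<longlonglongrightarrow> zs
                \<and> (\<exists>R>0. \<forall>k. sup_norm_pair ((G ^^ k) z0 - zs)
                              \<le> R * spectral_radius (map_mat complex_of_real A) ^ k))"
proof -
  interpret N: network_problem x y \<alpha> pw pu \<rho>w \<rho>u \<epsilon>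
    using assms by unfold_locales auto
  have \<Phi>: "\<Phi> = Phi x y \<alpha> \<epsilon>" and G: "G = G_map pw pu \<rho>w \<rho>u (Phi x y \<alpha> \<epsilon>)"
    using \<Phi>_def G_def by auto
  have xi: "N.xi1 \<rho>w \<rho>u = \<xi>1" "N.xi2 \<rho>w \<rho>u = \<xi>2" and \<alpha>max: "Max (range (\<lambda>l. \<bar>\<alpha> $ l\<bar>)) = N.\<alpha>max"
    by (simp_all add: N.xi1_def N.xi2_def N.\<rho>x_def N.\<alpha>max_def \<xi>1_def \<xi>2_def \<rho>x_def)
  let ?K = "real CARD('k)"
  let ?qw = "conj_exp pw - 1" and ?qu = "conj_exp pu - 1"
  have K: "?K \<ge> 1" by (simp add: Suc_leI)
  have q: "?qw > 0" "?qu > 0" using pw pu by (simp_all add: conj_exp_minus_1)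
  have \<xi>: "\<xi>1 \<ge> 0" "\<xi>2 \<ge> 0" using N.xi_nonneg[of \<rho>w \<rho>u] \<rho>w unfolding xi by auto
  let ?a = "4 * ?qw * \<xi>1" and ?b = "2 * ?qw * (2 * \<xi>2 + N.\<alpha>max)"
  let ?c = "2 * ?qu * (2 * \<xi>1 + 1)" and ?d = "2 * ?qu * (2 * \<xi>2 + N.\<alpha>max - 1)"
  \<comment> \<open>On vectors (s, ..., s, t) the K equal columns of A add up, which puts the factor
    K into the first column of the 2 by 2 matrix.\<close>
  have "?K * ?a \<ge> 0" "?b > 0" "?K * ?c > 0" "?d \<ge> 0"
    using K q \<xi> N.\<alpha>max_ge by (auto intro!: mult_pos_pos mult_nonneg_nonneg)
  then obtain \<mu> s t where \<mu>: "\<mu> > 0" and s: "s > 0" and t: "t > 0"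
    and eq: "?K * ?a * s + ?b * t = \<mu> * s" "?K * ?c * s + ?d * t = \<mu> * t"
    by (rule perron_2x2)
  have rad: "\<mu> \<le> spectral_radius (map_mat complex_of_real A)"
    using A_def eq t unfolding A_mat_def \<alpha>max by (rule block_constant_eigenvalue_le_spectral_radius)
  then have \<mu>1: "\<mu> < 1" using spec by simp
  \<comment> \<open>The contraction estimate contains \<open>?a * s\<close> and
    \<open>?c * s\<close> once, the eigenvalue equations K times; K \<ge> 1 turns the equations into
    the required inequalities.\<close>
  have "?a * s \<ge> 0" "?c * s \<ge> 0" using q \<xi> s by auto
  then have "1 * (?a * s) \<le> ?K * (?a * s)" "1 * (?c * s) \<le> ?K * (?c * s)"
    using K by (intro mult_right_mono; simp)+
  then have cs: "2 * (?qw * (2 * (N.xi1 \<rho>w \<rho>u * s + N.xi2 \<rho>w \<rho>u * t) + N.\<alpha>max * t)) \<le> \<mu> * s"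
    and ct: "2 * (?qu * (2 * (N.xi1 \<rho>w \<rho>u * s + N.xi2 \<rho>w \<rho>u * t) + (s + (N.\<alpha>max - 1) * t))) \<le> \<mu> * t"
    unfolding xi eq[symmetric] by (simp_all add: algebra_simps)
  note rate = N.funpow_G_rate[OF s t \<mu> cs ct]

  have p0: "pw > 0" "pu > 0" using pw pu by auto
  obtain zs where zs: "zs \<in> N.Sp" and max: "\<And>z. z \<in> N.Sp \<Longrightarrow> \<Phi> z \<le> \<Phi> zs"
    using continuous_attains_sup[OF compact_S_plus[OF p0] S_plus_nonempty[OF p0 \<rho>w \<rho>u]
        continuous_on_Phi[where x = x and y = y and \<epsilon> = \<epsilon>, OF N.\<alpha>_ge N.x_nonneg]] unfolding \<Phi> by blast
  have zspp: "zs \<in> N.Spp" using zs max N.maximizer_in_Spp unfolding \<Phi> by blast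
  have fixp: "N.G zs = zs" using zspp max N.maximizer_fixed_point unfolding \<Phi> by blast
  have lim: "(\<lambda>k. (G ^^ k) z0) \<longlonglongrightarrow> zs" if "z0 \<in> N.Spp" for z0
    using rate[OF that zspp fixp] N.funpow_G_tendsto[OF _ _ \<mu> \<mu>1] unfolding G by metis
  \<comment> \<open>Another maximizer is also a positive fixed point of G; its constant orbit
    converges to \<open>zs\<close>.\<close>
  have unique: "z = zs" if "z \<in> N.Sp" "\<And>z'. z' \<in> N.Sp \<Longrightarrow> \<Phi> z' \<le> \<Phi> z" for z
  proof -
    have zpp: "z \<in> N.Spp" using that N.maximizer_in_Spp unfolding \<Phi> by blast
    have "G z = z" using zpp that N.maximizer_fixed_point unfolding \<Phi> G by blast
    then have "(G ^^ k) z = z" for k by (induction k) auto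
    then have "(\<lambda>k::nat. z) \<longlonglongrightarrow> zs" using lim[OF zpp] by simp
    then show ?thesis by (simp add: LIMSEQ_const_iff)
  qed
  have bound: "\<exists>R>0. \<forall>k. sup_norm_pair ((G ^^ k) z0 - zs)
      \<le> R * spectral_radius (map_mat complex_of_real A) ^ k" if z0: "z0 \<in> N.Spp" for z0
  proof -
    obtain R where R: "R > 0"
      "\<And>k r l. \<bar>fst ((G ^^ k) z0) $ r $ l - fst zs $ r $ l\<bar> \<le> R * \<mu> ^ k"
      "\<And>k l m. \<bar>snd ((G ^^ k) z0) $ l $ m - snd zs $ l $ m\<bar> \<le> R * \<mu> ^ k"
      using rate[OF z0 zspp fixp] unfolding G by metis
    have "sup_norm_pair ((G ^^ k) z0 - zs) \<le> R * spectral_radius (map_mat complex_of_real A) ^ k" for k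
    proof -
      have "sup_norm_pair ((G ^^ k) z0 - zs) \<le> R * \<mu> ^ k"
        using R(2,3) by (intro sup_norm_pair_le) auto
      \<comment> \<open>The contraction rate is the Perron eigenvalue \<mu>; the stated rate follows
        from \<mu> \<le> \<rho>(A).\<close>
      also have "\<dots> \<le> R * spectral_radius (map_mat complex_of_real A) ^ k"
        using R(1) \<mu> rad by (intro mult_left_mono power_mono) auto
      finally show ?thesis .
    qed
    then show ?thesis using R(1) by blast
  qed
  show ?thesis using zs max unique zspp lim bound by blast
qed

end
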